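(* Let $f\in\mathbb{R}[x]=\mathbb{R}[x_1,\dots,x_n]$, let $G(x)$ be an $m\times m$ symmetric polynomial matrix, $l=\lceil\deg(G)/2\rceil$, and consider the problem of minimizing $f$ over $\mathcal{X}=\{x\in\{0,1\}^n: G(x)\succeq0\}$. For any integer $r\ge 3l$ (with $\deg f\le 2r$), the dual SDP problem corresponding to the hierarchy $$\mathrm{lb}(f,\widetilde{\mathcal{Q}}(\mathcal{X}))_r=\max\{t\in\mathbb{R}: f-t\in\widetilde{\mathcal{Q}}(\mathcal{X})_{2r}\}$$ is $$\begin{aligned}\min_{y\in\mathbb{R}^{s(n,2r)}}\ & L_y(f)\\ \text{subject to}\ & y_0=1,\ \mathbf{M}_r(y)\succeq0,\ \mathbf{M}_{r-1}\big((x_i(x_i-1))y\big)=0\ \ \forall i\in\{1,\dots,n\},\\ & L_y\big(P^G_{\lceil(\lfloor r/l\rfloor-1)/2\rceil}\big)\succeq0,\quad L_y\big(Q^G_{\lceil(\lfloor r/l\rfloor-1)/2\rceil-1}\big)\succeq0.\end{aligned}$$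
   Context: Notation: $\deg G$ is the maximum degree of the entries of $G$; $\mathbb{N}^n_r=\{\alpha\in\mathbb{N}^n:|\alpha|\le r\}$, $s(n,r)=\binom{n+r}{n}=|\mathbb{N}^n_r|$; $b_r(x)=(x^\alpha)_{\alpha\in\mathbb{N}^n_r}$ is the column vector of monomials of degree at most $r$; $\langle A,B\rangle=\mathrm{tr}(A^\top B)$. For $h(t)=\sum_i h_it^i\in\mathbb{R}[t]$, $h(G(x))=\sum_i h_iG(x)^i$ with $G(x)^0=I_m$. For a sequence $y=(y_\alpha)$ indexed by monomial exponents, the Riesz functional is $L_y(\sum_\alpha p_\alpha x^\alpha)=\sum_\alpha p_\alpha y_\alpha$, and $L_y$ acts entrywise on polynomial matrices. $\mathbf{M}_r(y)=L_y(b_rb_r^\top)$ is the moment matrix and $\mathbf{M}_{r-1}(gy)=L_y(g\,b_{r-1}b_{r-1}^\top)$ is the localizing matrix of a polynomial $g$. For an integer $v\ge0$, $P^G_v(x)$ and $Q^G_v(x)$ are the $(v+1)\times(v+1)$ polynomial matrices with entries, for $0\le i,j\le v$, $$[P^G_v(x)]_{i,j}=\mathrm{tr}(G(x)^{i+j+1}),\qquad[Q^G_v(x)]_{i,j}=\mathrm{tr}(G(x)^{i+j+1})-\mathrm{tr}(G(x)^{i+j+3}).$$ $\widetilde{\mathcal{Q}}(\mathcal{X})_{2r}=\mathcal{Q}(\{0,1\}^n)_{2r}+\mathcal{H}(G)_{\lfloor r/l\rfloor-1}$, where $\mathcal{Q}(\{0,1\}^n)_{2r}$ is the set of polynomials $\sigma+\sum_ip_i(x_i^2-x_i)$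 with $\sigma$ a sum of squares of degree at most $2r$ and $p_i\in\mathbb{R}[x]$, $\deg p_i\le2r-2$, and $\mathcal{H}(G)_k=\{\langle h(G(x)),G(x)\rangle: h\in\mathbb{R}[t],\ \deg h\le k,\ h\ge0\text{ on }[-1,1]\}$. With $k=\lfloor r/l\rfloor-1$, the SDP corresponding to the hierarchy is obtained by writing $h(t)=h_1(t)+(1-t^2)h_2(t)$ with $h_1,h_2$ univariate sums of squares of degrees at most $2\lceil k/2\rceil$ and $2\lceil k/2\rceil-2$, represented by Gram matrices $Y$ and $Z$: maximize $t$ subject to $$f(x)-t=\langle X,b_rb_r^\top\rangle+\sum_{i=1}^n\langle X_i,x_i(x_i-1)b_{r-1}b_{r-1}^\top\rangle+\langle Y,P^G_{\lceil k/2\rceil}(x)\rangle+\langle Z,Q^G_{\lceil k/2\rceil-1}(x)\rangle$$ (imposed coefficientwise for $\alpha\in\mathbb{N}^n_{2r}$), where $X\succeq0$ has size $s(n,r)$, $X_i$ is symmetric of size $s(n,r-1)$, $Y\succeq0$ has size $\lceil k/2\rceil+1$ and $Z\succeq0$ has size $\lceil k/2\rceil$; here $P^G_{\lceil k/2\rceil}$ and $Q^G_{\lceil k/2\rceil-1}$ are expanded as $\sum_{\alpha\in\mathbb{N}^n_{2r}}P_\alpha x^\alpha$ and $\sum_{\alpha\in\mathbb{N}^n_{2r}}Q_\alpha x^\alpha$. "Dual" means the standard conic dual, with $y_\alpha$ the multiplier of the $\alpha$-th coefficient identity. *)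

theory Defs
  imports
    "HOL-Analysis.Analysis"
    "HOL-Library.Poly_Mapping"
    "HOL-Computational_Algebra.Polynomial"
begin

section \<open>Polynomials in finitely many variables\<close>

text \<open>The variables are indexed by a finite type \<open>'n\<close>, so that \<open>'n \<Rightarrow>\<^sub>0 nat\<close> is the set of
  exponents $\mathbb{N}^n$ with $n$ the cardinality of \<open>'n\<close>. Multiplication on the type
  \<open>'n mpoly\<close> is the convolution product of \<^theory>\<open>HOL-Library.Poly_Mapping\<close>, i.e. polynomial
  multiplication.\<close>

type_synonym 'n exponent = "'n \<Rightarrow>\<^sub>0 nat"
type_synonym 'n mpoly = "('n \<Rightarrow>\<^sub>0 nat) \<Rightarrow>\<^sub>0 real"

definition exp_deg :: "'n::finite exponent \<Rightarrow> nat" where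
  "exp_deg \<alpha> = (\<Sum>i\<in>UNIV. Poly_Mapping.lookup \<alpha> i)"

definition exps_upto :: "nat \<Rightarrow> ('n::finite exponent) set" where
  "exps_upto r = {\<alpha>. exp_deg \<alpha> \<le> r}"

definition coef :: "'n::finite mpoly \<Rightarrow> 'n exponent \<Rightarrow> real" where
  "coef p \<alpha> = Poly_Mapping.lookup p \<alpha>"

definition xpow :: "'n::finite exponent \<Rightarrow> 'n mpoly" where
  "xpow \<alpha> = Poly_Mapping.single \<alpha> 1"

definition xvar :: "'n::finite \<Rightarrow> 'n mpoly" where
  "xvar i = xpow (Poly_Mapping.single i 1)"

definition const_poly :: "real \<Rightarrow> 'n::finite mpoly" where
  "const_poly c = Poly_Mapping.single 0 c"

text \<open>Total degree; the zero polynomial gets degree \<open>0\<close>.\<close>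

definition total_deg :: "'n::finite mpoly \<Rightarrow> nat" where
  "total_deg p = Max (insert 0 (exp_deg ` Poly_Mapping.keys p))"

definition sum_of_squares :: "'a::comm_semiring_1 \<Rightarrow> bool" where
  "sum_of_squares p \<longleftrightarrow> (\<exists>qs. p = (\<Sum>q\<leftarrow>qs. q\<^sup>2))"


section \<open>Matrices indexed by a finite set\<close>

text \<open>The matrices whose size depends on the relaxation order are functions of two indices;
  only the entries in \<open>I \<times> I\<close> matter, where \<open>I\<close> is the index set (\<open>exps_upto r\<close> for the moment
  matrices, of size $s(n,r)$, and \<open>{..v}\<close> for the matrices of size $v+1$).\<close>

definition sym_on :: "'i set \<Rightarrow> ('i \<Rightarrow> 'i \<Rightarrow> 'a) \<Rightarrow> bool" where
  "sym_on I A \<longleftrightarrow> (\<forall>i\<in>I. \<forall>j\<in>I. A i j = A j i)"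

definition psd_on :: "'i set \<Rightarrow> ('i \<Rightarrow> 'i \<Rightarrow> real) \<Rightarrow> bool" where
  "psd_on I A \<longleftrightarrow> sym_on I A \<and> (\<forall>v. 0 \<le> (\<Sum>i\<in>I. \<Sum>j\<in>I. v i * A i j * v j))"

text \<open>$\langle A, B\rangle = \mathrm{tr}(A^\top B)$ for a real matrix \<open>A\<close> and a polynomial matrix \<open>B\<close>.\<close>

definition pairing :: "'i set \<Rightarrow> ('i \<Rightarrow> 'i \<Rightarrow> real) \<Rightarrow> ('i \<Rightarrow> 'i \<Rightarrow> 'n::finite mpoly) \<Rightarrow> 'n mpoly" where
  "pairing I A B = (\<Sum>j\<in>I. \<Sum>i\<in>I. const_poly (A i j) * B i j)"


section \<open>Polynomial matrices\<close>

text \<open>The power of a square matrix with respect to \<open>**\<close>; the class operation \<open>^\<close> on vectors is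
  componentwise.\<close>

definition mat_pow :: "'a::semiring_1^'m^'m \<Rightarrow> nat \<Rightarrow> 'a^'m^'m" where
  "mat_pow A k = (((**) A) ^^ k) (mat 1)"

definition mat_deg :: "('n::finite mpoly)^'m^'m \<Rightarrow> nat" where
  "mat_deg G = Max {total_deg (G $ a $ b) | a b. True}"

definition poly_at_mat :: "real poly \<Rightarrow> ('n::finite mpoly)^'m^'m \<Rightarrow> ('n mpoly)^'m^'m" where
  "poly_at_mat h G = (\<chi> a b. \<Sum>i\<le>degree h. const_poly (coeff h i) * mat_pow G i $ a $ b)"

definition P_mat :: "('n::finite mpoly)^'m^'m \<Rightarrow> nat \<Rightarrow> nat \<Rightarrow> 'n mpoly" where
  "P_mat G i j = trace (mat_pow G (i + j + 1))"

definition Q_mat :: "('n::finite mpoly)^'m^'m \<Rightarrow> nat \<Rightarrow> nat \<Rightarrow> 'n mpoly" where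
  "Q_mat G i j = trace (mat_pow G (i + j + 1)) - trace (mat_pow G (i + j + 3))"


section \<open>The hierarchy\<close>

definition half_deg :: "('n::finite mpoly)^'m^'m \<Rightarrow> nat" where
  "half_deg G = nat \<lceil>real (mat_deg G) / 2\<rceil>"

text \<open>The bound $k = \lfloor r/l\rfloor - 1$ on the degree of \<open>h\<close>, and $\lceil k/2\rceil$.\<close>

definition h_deg :: "('n::finite mpoly)^'m^'m \<Rightarrow> nat \<Rightarrow> nat" where
  "h_deg G r = r div half_deg G - 1"

definition gram_ord :: "('n::finite mpoly)^'m^'m \<Rightarrow> nat \<Rightarrow> nat" where
  "gram_ord G r = nat \<lceil>real (h_deg G r) / 2\<rceil>"

text \<open>The parameter of \<open>cube_module\<close> is \<open>r\<close>, while the degree of the truncation is \<open>2 * r\<close>.\<close>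

definition cube_module :: "nat \<Rightarrow> ('n::finite mpoly) set" where
  "cube_module r =
    {\<sigma> + (\<Sum>i\<in>UNIV. p i * ((xvar i)\<^sup>2 - xvar i)) | \<sigma> p.
       sum_of_squares \<sigma> \<and> total_deg \<sigma> \<le> 2 * r \<and> (\<forall>i. total_deg (p i) \<le> 2 * r - 2)}"

definition H_set :: "('n::finite mpoly)^'m^'m \<Rightarrow> nat \<Rightarrow> ('n mpoly) set" where
  "H_set G k = {trace (transpose (poly_at_mat h G) ** G) | h.
     degree h \<le> k \<and> (\<forall>t\<in>{-1..1}. 0 \<le> poly h t)}"

definition Q_tilde :: "('n::finite mpoly)^'m^'m \<Rightarrow> nat \<Rightarrow> ('n mpoly) set" where
  "Q_tilde G r = {p + q | p q. p \<in> cube_module r \<and> q \<in> H_set G (h_deg G r)}"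

definition lb :: "'n::finite mpoly \<Rightarrow> ('n mpoly)^'m^'m \<Rightarrow> nat \<Rightarrow> ereal" where
  "lb f G r = (SUP t \<in> {t. f - const_poly t \<in> Q_tilde G r}. ereal t)"


section \<open>Conic programs and their duals\<close>

text \<open>The program $\max\, c(x)$ subject to $A_i(x) = b_i$ for $i \in I$ and $x \in K$. It is
  meant to be used with a convex cone $K$ in a real vector space, linear $c$ and $A_i$, and a finite
  index set $I$. Its conic dual is $\min\, \sum_i b_i y_i$ over $y \in \mathbb{R}^I$ subject to
  $A^* y - c \in K^*$, where $A^* y = \sum_i y_i A_i$. Unconstrained primal variables are
  covered by letting the cone $K$ be a whole space in these directions.\<close>

record ('e, 'i) conic_program =
  cp_cone :: "'e set"
  cp_obj :: "'e \<Rightarrow> real"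
  cp_index :: "'i set"
  cp_lhs :: "'i \<Rightarrow> 'e \<Rightarrow> real"
  cp_rhs :: "'i \<Rightarrow> real"

definition dual_cone :: "'e set \<Rightarrow> ('e \<Rightarrow> real) set" where
  "dual_cone K = {\<phi>. \<forall>x\<in>K. 0 \<le> \<phi> x}"

definition conic_feasible :: "('e, 'i) conic_program \<Rightarrow> 'e set" where
  "conic_feasible C = {x \<in> cp_cone C. \<forall>i\<in>cp_index C. cp_lhs C i x = cp_rhs C i}"

definition conic_value :: "('e, 'i) conic_program \<Rightarrow> ereal" where
  "conic_value C = (SUP x \<in> conic_feasible C. ereal (cp_obj C x))"

text \<open>$\mathbb{R}^I$, embedded by extension by zero.\<close>

definition coord_space :: "'i set \<Rightarrow> ('i \<Rightarrow> real) set" where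
  "coord_space I = {y. \<forall>i. i \<notin> I \<longrightarrow> y i = 0}"

text \<open>A minimization problem is the pair of its feasible set and its objective function.\<close>

type_synonym 'y min_problem = "'y set \<times> ('y \<Rightarrow> real)"

definition conic_dual :: "('e, 'i) conic_program \<Rightarrow> ('i \<Rightarrow> real) min_problem" where
  "conic_dual C =
    ({y \<in> coord_space (cp_index C).
        (\<lambda>x. (\<Sum>i\<in>cp_index C. y i * cp_lhs C i x) - cp_obj C x) \<in> dual_cone (cp_cone C)},
     \<lambda>y. \<Sum>i\<in>cp_index C. cp_rhs C i * y i)"


section \<open>The SDP corresponding to the hierarchy\<close>

text \<open>The primal variables are $(t, X, (X_i)_i, Y, Z)$.\<close>

type_synonym 'n sdp_var =
  "real \<times> ('n exponent \<Rightarrow> 'n exponent \<Rightarrow> real) \<times> ('n \<Rightarrow> 'n exponent \<Rightarrow> 'n exponent \<Rightarrow> real)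
    \<times> (nat \<Rightarrow> nat \<Rightarrow> real) \<times> (nat \<Rightarrow> nat \<Rightarrow> real)"

definition sdp_poly :: "('n::finite mpoly)^'m^'m \<Rightarrow> nat \<Rightarrow> 'n sdp_var \<Rightarrow> 'n mpoly" where
  "sdp_poly G r = (\<lambda>(t, X, Xs, Y, Z).
     const_poly t
     + pairing (exps_upto r) X (\<lambda>\<alpha> \<beta>. xpow \<alpha> * xpow \<beta>)
     + (\<Sum>i\<in>UNIV. pairing (exps_upto (r - 1)) (Xs i)
          (\<lambda>\<alpha> \<beta>. xvar i * (xvar i - 1) * (xpow \<alpha> * xpow \<beta>)))
     + pairing {..gram_ord G r} Y (P_mat G)
     + pairing {..gram_ord G r - 1} Z (Q_mat G))"

text \<open>The constraint \<open>f - t = \<dots>\<close> is imposed in the form \<open>f = t + \<dots>\<close>, coefficientwise for the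
  exponents of degree at most \<open>2 * r\<close>. For odd $k$ the polynomials in \<open>P_mat\<close> and \<open>Q_mat\<close> can have
  degree up to $(k+2)\deg G$, which can exceed $2r$; only their coefficients up to degree $2r$
  then enter, and the value of the program can be larger than \<open>lb\<close>.\<close>

definition hierarchy_sdp ::
  "'n::finite mpoly \<Rightarrow> ('n mpoly)^'m^'m \<Rightarrow> nat \<Rightarrow> ('n sdp_var, 'n exponent) conic_program" where
  "hierarchy_sdp f G r =
    \<lparr> cp_cone = {(t, X, Xs, Y, Z).
          psd_on (exps_upto r) X \<and> (\<forall>i. sym_on (exps_upto (r - 1)) (Xs i))
          \<and> psd_on {..gram_ord G r} Y \<and> psd_on {..gram_ord G r - 1} Z},
      cp_obj = (\<lambda>(t, X, Xs, Y, Z). t),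
      cp_index = exps_upto (2 * r),
      cp_lhs = (\<lambda>\<alpha> x. coef (sdp_poly G r x) \<alpha>),
      cp_rhs = coef f \<rparr>"


section \<open>Riesz functional, moment and localizing matrices\<close>

text \<open>For \<open>y\<close> in \<open>coord_space (exps_upto (2 * r))\<close>, monomials of degree above \<open>2 * r\<close> contribute
  nothing, in agreement with the truncated coefficient identities above.\<close>

definition riesz :: "('n::finite exponent \<Rightarrow> real) \<Rightarrow> 'n mpoly \<Rightarrow> real" where
  "riesz y p = (\<Sum>\<alpha>\<in>Poly_Mapping.keys p. coef p \<alpha> * y \<alpha>)"

definition moment_mat :: "('n::finite exponent \<Rightarrow> real) \<Rightarrow> 'n exponent \<Rightarrow> 'n exponent \<Rightarrow> real" where
  "moment_mat y \<alpha> \<beta> = riesz y (xpow \<alpha> * xpow \<beta>)"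

definition localizing_mat ::
  "'n::finite mpoly \<Rightarrow> ('n exponent \<Rightarrow> real) \<Rightarrow> 'n exponent \<Rightarrow> 'n exponent \<Rightarrow> real" where
  "localizing_mat g y \<alpha> \<beta> = riesz y (g * (xpow \<alpha> * xpow \<beta>))"

end

theory Submission
  imports Defs "HOL-Computational_Algebra.Fundamental_Theorem_Algebra"
begin

text \<open>The description of the dual amounts to the self-duality of the cone of positive semidefinite
  matrices, applied to each block of variables after moving the Riesz functional inside the
  pairings; the free variables \<open>t\<close> and \<open>X\<^sub>i\<close> give the equality constraints.

  For the comparison with the hierarchy, leading terms cannot cancel in a sum of squares, so one
  of degree at most \<open>2r\<close> is a Gram matrix expression in the monomials up to degree \<open>r\<close>. A
  univariate polynomial of degree at most \<open>2v\<close> that is nonnegative on \<open>[-1,1]\<close> is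
  \<open>\<sigma>\<^sub>1 + (1 - t\<^sup>2)\<sigma>\<^sub>2\<close> with sums of squares of degrees at most \<open>2v\<close> and \<open>2v - 2\<close>
  (Lukacs): the set of these expressions is multiplicative, and one splits off quadratic
  factors coming from a pair of conjugate roots, a double root in \<open>(-1,1)\<close> or two
  roots outside. For even \<open>k\<close> no term of the program exceeds degree \<open>2r\<close>, so that
  the truncated coefficient identities are identities of polynomials.\<close>

section \<open>Positive semidefinite matrices\<close>

lemma psd_onD: "psd_on I A \<Longrightarrow> 0 \<le> (\<Sum>i\<in>I. \<Sum>j\<in>I. v i * A i j * v j)"
  by (simp add: psd_on_def)

lemma psd_on_sym: "psd_on I A \<Longrightarrow> i \<in> I \<Longrightarrow> j \<in> I \<Longrightarrow> A i j = A j i"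
  by (simp add: psd_on_def sym_on_def)

lemma psd_on_zero: "psd_on I (\<lambda>i j. 0)"
  by (simp add: psd_on_def sym_on_def)

lemma psd_on_rank_one: "psd_on I (\<lambda>i j. u i * u j)"
proof -
  have "(\<Sum>i\<in>I. \<Sum>j\<in>I. v i * (u i * u j) * v j) = (\<Sum>i\<in>I. v i * u i)\<^sup>2" for v
    unfolding power2_eq_square sum_product by (simp add: algebra_simps)
  then show ?thesis by (simp add: psd_on_def sym_on_def)
qed

lemma psd_on_add:
  assumes "psd_on I A" "psd_on I B"
  shows "psd_on I (\<lambda>i j. A i j + B i j)"
proof -
  have "(\<Sum>i\<in>I. \<Sum>j\<in>I. v i * (A i j + B i j) * v j) =
      (\<Sum>i\<in>I. \<Sum>j\<in>I. v i * A i j * v j) + (\<Sum>i\<in>I. \<Sum>j\<in>I. v i * B i j * v j)" for v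
    by (simp add: algebra_simps sum.distrib)
  with assms show ?thesis by (auto simp: psd_on_def sym_on_def)
qed

text \<open>Positivity of the 2x2 matrix with diagonal \<open>q\<close>, \<open>a\<close> and
  off-diagonal entry \<open>b\<close>, read off from the vectors \<open>(1, c)\<close>. Division by
  zero gives \<open>0\<close>, so for \<open>a = 0\<close> the last bound just says that
  \<open>q\<close> is nonnegative.\<close>

lemma nonneg_quadratic_Schur:
  fixes a b q :: real
  assumes "\<And>c. 0 \<le> q + 2 * c * b + c\<^sup>2 * a"
  shows "0 \<le> a" "a = 0 \<Longrightarrow> b = 0" "b * b / a \<le> q"
proof -
  have q: "0 \<le> q" using assms[of 0] by simp
  show b: "b = 0" if "a = 0"
  proof (rule ccontr)
    assume "b \<noteq> 0"
    \<comment> \<open>This \<open>c\<close> makes \<open>q + 2 * c * b\<close> equal to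
      \<open>-1\<close>.\<close>
    then show False using assms[of "- (q + 1) / (2 * b)"] q that by (simp add: field_simps)
  qed
  show a: "0 \<le> a"
  proof (rule ccontr)
    assume "\<not> 0 \<le> a"
    then have n: "a < 0" by simp
    \<comment> \<open>Chosen so that \<open>2 * b + c * a\<close> is at most \<open>- q - 1\<close>
      while \<open>c\<close> is at least \<open>1\<close>; the quadratic is then at most
      \<open>-1\<close>.\<close>
    define c where "c = (2 * \<bar>b\<bar> + q + 1) / - a + 1"
    have c: "1 \<le> c" using n q by (simp add: c_def divide_nonneg_neg)
    have e: "c * a = - (2 * \<bar>b\<bar> + q + 1) + a" using n by (simp add: c_def field_simps)
    have "q + 2 * c * b + c\<^sup>2 * a = q + c * (2 * b + c * a)" by (simp add: algebra_simps power2_eq_square)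
    also have "\<dots> \<le> q + c * (- q - 1)"
      by (intro add_left_mono mult_left_mono) (use e n c in auto)
    also have "\<dots> \<le> q + 1 * (- q - 1)"
      by (intro add_left_mono mult_right_mono_neg) (use c q in auto)
    finally show False using assms[of c] by simp
  qed
  show "b * b / a \<le> q"
  proof (cases "a = 0")
    case False
    \<comment> \<open>The minimizer \<open>c = - b / a\<close> gives the sharpest bound.\<close>
    have "0 \<le> q + 2 * (- b / a) * b + (- b / a)\<^sup>2 * a" by (rule assms)
    also have "\<dots> = q - b * b / a" using False by (simp add: field_simps power2_eq_square)
    finally show ?thesis by simp
  qed (use q in simp)
qed

text \<open>Symmetric Gaussian elimination: split off the rank one matrix given by row \<open>k\<close>
  and pass to the Schur complement.\<close>

lemma psd_on_Schur:
  assumes "finite I" "k \<notin> I" and psd: "psd_on (insert k I) A"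
  shows "0 \<le> A k k" "i \<in> I \<Longrightarrow> A k k = 0 \<Longrightarrow> A i k = 0"
    and "psd_on I (\<lambda>i j. A i j - A i k * A j k / A k k)"
proof -
  have sym: "A i j = A j i" if "i \<in> insert k I" "j \<in> insert k I" for i j
    using psd_on_sym[OF psd] that by blast
  \<comment> \<open>The form of \<open>A\<close> at the vector \<open>v(k := c)\<close>, seen as a
    quadratic in the free coordinate \<open>c\<close>.\<close>
  have quad: "0 \<le> (\<Sum>i\<in>I. \<Sum>j\<in>I. v i * A i j * v j)
      + 2 * c * (\<Sum>i\<in>I. v i * A i k) + c\<^sup>2 * A k k" for v c
  proof -
    have "0 \<le> (\<Sum>i\<in>insert k I. \<Sum>j\<in>insert k I. (v(k := c)) i * A i j * (v(k := c)) j)"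
      by (rule psd_onD[OF psd])
    also have "\<dots> = c * A k k * c + (\<Sum>j\<in>I. c * A k j * v j)
        + (\<Sum>i\<in>I. v i * A i k * c + (\<Sum>j\<in>I. v i * A i j * v j))"
    proof -
      have ne: "i \<in> I \<Longrightarrow> i \<noteq> k" for i using assms(2) by auto
      show ?thesis
        using assms(1,2) by (simp add: sum.distrib ne cong: sum.cong)
    qed
    also have "(\<Sum>j\<in>I. c * A k j * v j) = c * (\<Sum>i\<in>I. v i * A i k)"
      unfolding sum_distrib_left by (intro sum.cong) (auto simp: sym)
    also have "c * A k k * c + c * (\<Sum>i\<in>I. v i * A i k)
        + (\<Sum>i\<in>I. v i * A i k * c + (\<Sum>j\<in>I. v i * A i j * v j))
      = (\<Sum>i\<in>I. \<Sum>j\<in>I. v i * A i j * v j) + 2 * c * (\<Sum>i\<in>I. v i * A i k) + c\<^sup>2 * A k k"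
      by (simp add: sum.distrib sum_distrib_left power2_eq_square algebra_simps)
    finally show ?thesis .
  qed
  show "0 \<le> A k k" by (rule nonneg_quadratic_Schur(1)[OF quad])
  \<comment> \<open>For the unit vector at \<open>i\<close>, the linear coefficient of the quadratic
    is \<open>A i k\<close>.\<close>
  show "A i k = 0" if "i \<in> I" "A k k = 0"
    using nonneg_quadratic_Schur(2)[OF quad[of "\<lambda>j. if j = i then 1 else 0"] that(2)] that(1) assms(1)
    by (simp add: if_distrib[of "\<lambda>x. x * _"] sum.delta cong: if_cong)
  show "psd_on I (\<lambda>i j. A i j - A i k * A j k / A k k)"
    unfolding psd_on_def
  proof (intro conjI allI)
    show "sym_on I (\<lambda>i j. A i j - A i k * A j k / A k k)"
      by (auto simp: sym_on_def sym)
    fix v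
    have "(\<Sum>i\<in>I. \<Sum>j\<in>I. v i * (A i j - A i k * A j k / A k k) * v j)
      = (\<Sum>i\<in>I. \<Sum>j\<in>I. v i * A i j * v j)
        - (\<Sum>i\<in>I. v i * A i k) * (\<Sum>i\<in>I. v i * A i k) / A k k"
      unfolding sum_product sum_divide_distrib sum_subtractf[symmetric]
      by (intro sum.cong refl) (simp add: algebra_simps diff_divide_distrib)
    with nonneg_quadratic_Schur(3)[OF quad]
    show "0 \<le> (\<Sum>i\<in>I. \<Sum>j\<in>I. v i * (A i j - A i k * A j k / A k k) * v j)" by simp
  qed
qed

text \<open>Induction on the index set: the Schur complement has a Gram decomposition on the smaller
  set, and the rank one matrix that was split off contributes one more vector.\<close>

lemma psd_on_imp_Gram:
  assumes "finite I" "psd_on I A"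
  shows "\<exists>ws. \<forall>i\<in>I. \<forall>j\<in>I. A i j = (\<Sum>w\<leftarrow>ws. w i * w j)"
  using assms
proof (induction I arbitrary: A rule: finite_induct)
  case (insert k I)
  note Schur = psd_on_Schur[OF insert.hyps insert.prems]
  have sym: "A i j = A j i" if "i \<in> insert k I" "j \<in> insert k I" for i j
    using psd_on_sym[OF insert.prems] that by blast
  obtain ws where ws: "\<And>i j. i \<in> I \<Longrightarrow> j \<in> I \<Longrightarrow>
      A i j - A i k * A j k / A k k = (\<Sum>w\<leftarrow>ws. w i * w j)"
    using insert.IH[OF Schur(3)] by blast
  \<comment> \<open>If \<open>A k k = 0\<close>, division by zero makes \<open>u\<close> vanish, as
    it should: \<open>Schur(2)\<close> says that row \<open>k\<close> is zero.\<close>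
  define u where "u = (\<lambda>i. A i k / sqrt (A k k))"
  \<comment> \<open>The induction hypothesis controls the vectors only on \<open>I\<close>;
    resetting them at \<open>k\<close> leaves row \<open>k\<close> to \<open>u\<close>
    alone.\<close>
  define us where "us = u # map (\<lambda>w. w(k := 0)) ws"
  have uu: "u i * u j = A i k * A j k / A k k" for i j
    using Schur(1) by (simp add: u_def)
  have "A i j = (\<Sum>w\<leftarrow>us. w i * w j)" if "i \<in> insert k I" "j \<in> insert k I" for i j
  proof (cases "i = k \<or> j = k")
    case True
    then have "(\<Sum>w\<leftarrow>us. w i * w j) = A i k * A j k / A k k"
      by (auto simp: us_def uu o_def)
    also have "\<dots> = A i j"
      using True that Schur(2)[of i] Schur(2)[of j] sym[OF that] by (cases "A k k = 0") auto
    finally show ?thesis by simp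
  next
    case False
    then show ?thesis using ws[of i j] that by (simp add: us_def uu o_def)
  qed
  then show ?case by blast
qed simp

section \<open>The trace inner product and dual cones of matrices\<close>

lemma sum_sum_list_swap:
  "(\<Sum>i\<in>I. \<Sum>w\<leftarrow>ws. f i w) = (\<Sum>w\<leftarrow>ws. \<Sum>i\<in>I. f i w)"
  by (induction ws) (simp_all add: sum.distrib)

text \<open>Real counterpart of \<open>pairing\<close>, with the sums in the same order, so that
  \<open>riesz\<close> of a pairing unfolds directly to it.\<close>

definition mat_inner :: "'i set \<Rightarrow> ('i \<Rightarrow> 'i \<Rightarrow> real) \<Rightarrow> ('i \<Rightarrow> 'i \<Rightarrow> real) \<Rightarrow> real" where
  "mat_inner I A B = (\<Sum>j\<in>I. \<Sum>i\<in>I. A i j * B i j)"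

lemma mat_inner_zero [simp]: "mat_inner I (\<lambda>i j. 0) B = 0"
  by (simp add: mat_inner_def)

text \<open>A Gram decomposition of \<open>A\<close> turns the inner product into a sum of values of
  the quadratic form of \<open>B\<close>.\<close>

lemma psd_on_inner_nonneg:
  assumes "finite I" "psd_on I A" "psd_on I B"
  shows "0 \<le> mat_inner I A B"
proof -
  obtain ws where ws: "\<And>i j. i \<in> I \<Longrightarrow> j \<in> I \<Longrightarrow> A i j = (\<Sum>w\<leftarrow>ws. w i * w j)"
    using psd_on_imp_Gram[OF assms(1,2)] by blast
  have "mat_inner I A B = (\<Sum>i\<in>I. \<Sum>j\<in>I. \<Sum>w\<leftarrow>ws. w i * B i j * w j)"
    unfolding mat_inner_def
  proof (subst sum.swap, intro sum.cong refl)
    fix i j assume "i \<in> I" "j \<in> I"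
    moreover have "(\<Sum>w\<leftarrow>ws. w i * B i j * w j) = (\<Sum>w\<leftarrow>ws. w i * w j * B i j)"
      by (intro arg_cong[of _ _ sum_list] map_cong) simp_all
    ultimately show "A i j * B i j = (\<Sum>w\<leftarrow>ws. w i * B i j * w j)"
      by (simp add: ws sum_list_mult_const)
  qed
  also have "\<dots> = (\<Sum>w\<leftarrow>ws. \<Sum>i\<in>I. \<Sum>j\<in>I. w i * B i j * w j)"
    by (simp add: sum_sum_list_swap)
  also have "\<dots> \<ge> 0" by (intro sum_list_nonneg) (auto simp: psd_onD[OF assms(3)])
  finally show ?thesis .
qed

text \<open>The rank one matrices are the test matrices that recover the quadratic form of
  \<open>B\<close>.\<close>

lemma psd_on_self_dual:
  assumes "finite I" "sym_on I B"
  shows "(\<forall>A. psd_on I A \<longrightarrow> 0 \<le> mat_inner I A B) \<longleftrightarrow> psd_on I B"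
proof
  assume *: "\<forall>A. psd_on I A \<longrightarrow> 0 \<le> mat_inner I A B"
  have "0 \<le> (\<Sum>i\<in>I. \<Sum>j\<in>I. v i * B i j * v j)" for v
  proof -
    have "0 \<le> mat_inner I (\<lambda>i j. v i * v j) B" using * psd_on_rank_one by blast
    also have "\<dots> = (\<Sum>i\<in>I. \<Sum>j\<in>I. v i * B i j * v j)"
      unfolding mat_inner_def by (subst sum.swap) (simp add: ac_simps)
    finally show ?thesis .
  qed
  then show "psd_on I B" using assms(2) by (simp add: psd_on_def)
next
  assume "psd_on I B"
  then show "\<forall>A. psd_on I A \<longrightarrow> 0 \<le> mat_inner I A B"
    using psd_on_inner_nonneg[OF assms(1)] by blast
qed

text \<open>The symmetric matrices form a linear space, so \<open>- B\<close> is itself a test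
  matrix, and it yields minus the squared Frobenius norm of \<open>B\<close>.\<close>

lemma sym_on_dual:
  fixes B :: "'i \<Rightarrow> 'i \<Rightarrow> real"
  assumes "finite I" "sym_on I B"
  shows "(\<forall>A. sym_on I A \<longrightarrow> 0 \<le> mat_inner I A B) \<longleftrightarrow> (\<forall>i\<in>I. \<forall>j\<in>I. B i j = 0)"
proof
  assume *: "\<forall>A. sym_on I A \<longrightarrow> 0 \<le> mat_inner I A B"
  have "sym_on I (\<lambda>i j. - B i j)" using assms(2) by (simp add: sym_on_def)
  with * have "0 \<le> mat_inner I (\<lambda>i j. - B i j) B" by blast
  then have "(\<Sum>j\<in>I. \<Sum>i\<in>I. (B i j)\<^sup>2) \<le> 0"
    by (simp add: mat_inner_def sum_negf power2_eq_square)
  then have "(\<Sum>j\<in>I. \<Sum>i\<in>I. (B i j)\<^sup>2) = 0"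
    by (intro antisym sum_nonneg) auto
  then show "\<forall>i\<in>I. \<forall>j\<in>I. B i j = 0"
    using assms(1) by (simp add: sum_nonneg_eq_0_iff sum_nonneg)
qed (simp add: mat_inner_def)

section \<open>Nonnegative polynomials on an interval\<close>

text \<open>The polynomials \<open>\<sigma>\<^sub>1 + (1 - t\<^sup>2)\<sigma>\<^sub>2\<close> with
  summands of degree at most \<open>2 * v\<close>. The inductive form lets closure properties be
  proved by rule induction. No weighted square is available for \<open>v = 0\<close>.\<close>

inductive interval_cert :: "nat \<Rightarrow> real poly \<Rightarrow> bool" where
  zero: "interval_cert v 0"
| square: "degree q \<le> v \<Longrightarrow> interval_cert v (q\<^sup>2)"
| weighted: "degree q + 1 \<le> v \<Longrightarrow> interval_cert v ([:1, 0, -1:] * q\<^sup>2)"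
| add: "interval_cert v p \<Longrightarrow> interval_cert v q \<Longrightarrow> interval_cert v (p + q)"

lemma interval_cert_mono: "interval_cert v p \<Longrightarrow> v \<le> w \<Longrightarrow> interval_cert w p"
proof (induction rule: interval_cert.induct)
  case (weighted q v)
  then show ?case by (intro interval_cert.weighted) simp
qed (auto intro: interval_cert.intros)

text \<open>It suffices to multiply generators. The critical product is that of two weighted
  squares, where the two weights combine into a square.\<close>

lemma interval_cert_mult:
  assumes "interval_cert v p" "interval_cert w q"
  shows "interval_cert (v + w) (p * q)"
  using assms
proof (induction rule: interval_cert.induct)
  case (square p v)
  show ?case using square(2,1)
  proof (induction rule: interval_cert.induct)
    case (square q w)
    then have "interval_cert (v + w) ((p * q)\<^sup>2)"
      by (intro interval_cert.square order.trans[OF degree_mult_le]) auto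
    then show ?case by (simp add: power_mult_distrib)
  next
    case (weighted q w)
    then have "interval_cert (v + w) ([:1, 0, -1:] * (p * q)\<^sup>2)"
      by (intro interval_cert.weighted) (use degree_mult_le[of p q] in linarith)
    then show ?case by (simp only: power_mult_distrib mult.left_commute)
  qed (auto simp: distrib_left intro: interval_cert.intros)
next
  case (weighted p v)
  show ?case using weighted(2,1)
  proof (induction rule: interval_cert.induct)
    case (square q w)
    then have "interval_cert (v + w) ([:1, 0, -1:] * (p * q)\<^sup>2)"
      by (intro interval_cert.weighted) (use degree_mult_le[of p q] in linarith)
    then show ?case by (simp only: power_mult_distrib mult.assoc)
  next
    case (weighted q w)
    \<comment> \<open>The weight has degree two, paid for by the slack of one in each of the two
      degree bounds.\<close>
    have "degree ([:1, 0, -1:] * (p * q)) \<le> v + w"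
      using degree_mult_le[of "[:1, 0, -1:]" "p * q"] degree_mult_le[of p q] weighted by simp
    then have "interval_cert (v + w) (([:1, 0, -1:] * (p * q))\<^sup>2)"
      by (rule interval_cert.square)
    moreover have "[:1, 0, -1:] * p\<^sup>2 * ([:1, 0, -1:] * q\<^sup>2) = ([:1, 0, -1:] * (p * q))\<^sup>2"
      unfolding power2_eq_square by (simp only: ac_simps)
    ultimately show ?case by simp
  qed (auto simp: distrib_left intro: interval_cert.intros)
qed (auto simp: distrib_right intro: interval_cert.intros)

lemma interval_cert_nonneg:
  "interval_cert v p \<Longrightarrow> t \<in> {-1..1} \<Longrightarrow> 0 \<le> poly p t"
proof (induction rule: interval_cert.induct)
  case (weighted q v)
  then have "0 \<le> (1 - t) * (1 + t)" by (intro mult_nonneg_nonneg) auto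
  moreover have "poly ([:1, 0, -1:] * q\<^sup>2) t = (1 - t) * (1 + t) * (poly q t)\<^sup>2"
    by (simp add: algebra_simps)
  ultimately show ?case by (simp del: poly_mult)
qed auto

lemma interval_cert_const: "0 \<le> c \<Longrightarrow> interval_cert v [:c:]"
  using interval_cert.square[of "[:sqrt c:]" v] by (simp add: power2_eq_square)

lemma interval_cert_smult:
  assumes "0 \<le> c" "interval_cert v p" shows "interval_cert v (smult c p)"
  using interval_cert_mult[OF interval_cert_const[OF assms(1), of 0] assms(2)] by simp

text \<open>The polynomial is a nonnegative combination of \<open>1 + t\<close> and
  \<open>1 - t\<close>, and \<open>2(1 + t) = (1 + t)\<^sup>2 + (1 - t\<^sup>2)\<close>, similarly
  for \<open>1 - t\<close>. The hypotheses are the values at \<open>1\<close> and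
  \<open>-1\<close>.\<close>

lemma interval_cert_linear:
  assumes "0 \<le> a + b" "0 \<le> a - b"
  shows "interval_cert 1 [:a, b:]"
proof -
  have *: "interval_cert 1 (smult ((a + b) / 4) ([:1, 1:]\<^sup>2 + [:1, 0, -1:] * 1\<^sup>2)
      + smult ((a - b) / 4) ([:1, -1:]\<^sup>2 + [:1, 0, -1:] * 1\<^sup>2))"
    using assms by (intro interval_cert.add interval_cert_smult interval_cert.square
      interval_cert.weighted) auto
  also have "smult ((a + b) / 4) ([:1, 1:]\<^sup>2 + [:1, 0, -1:] * 1\<^sup>2)
      + smult ((a - b) / 4) ([:1, -1:]\<^sup>2 + [:1, 0, -1:] * 1\<^sup>2) = [:a, b:]"
    by (simp add: power2_eq_square field_simps)
  finally show ?thesis .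
qed

text \<open>With \<open>p = \<alpha>(1 + t) + \<beta>(1 - t)\<close> and likewise \<open>q\<close>, the product only involves
  \<open>(1 + t)\<^sup>2\<close>, \<open>(1 - t)\<^sup>2\<close> and \<open>1 - t\<^sup>2\<close>.\<close>

lemma interval_cert_linear_mult:
  assumes "0 \<le> a + b" "0 \<le> a - b" "0 \<le> c + d" "0 \<le> c - d"
  shows "interval_cert 1 ([:a, b:] * [:c, d:])"
proof -
  have "interval_cert 1 (smult ((a + b) * (c + d) / 4) ([:1, 1:]\<^sup>2)
      + smult ((a - b) * (c - d) / 4) ([:1, -1:]\<^sup>2)
      + smult (((a + b) * (c - d) + (a - b) * (c + d)) / 4) ([:1, 0, -1:] * 1\<^sup>2))"
    using assms by (intro interval_cert.add interval_cert_smult interval_cert.square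
      interval_cert.weighted) auto
  also have "smult ((a + b) * (c + d) / 4) ([:1, 1:]\<^sup>2)
      + smult ((a - b) * (c - d) / 4) ([:1, -1:]\<^sup>2)
      + smult (((a + b) * (c - d) + (a - b) * (c + d)) / 4) ([:1, 0, -1:] * 1\<^sup>2) = [:a, b:] * [:c, d:]"
    by (simp add: power2_eq_square field_simps)
  finally show ?thesis .
qed

text \<open>If \<open>h\<close> were negative at \<open>x\<close>, it would be so on a whole
  interval, where \<open>q\<close> would have to vanish; a nonzero polynomial has only finitely many
  roots.\<close>

lemma nonneg_cofactor:
  fixes q h :: "real poly"
  assumes "q \<noteq> 0" and q: "\<And>t. t \<in> {-1..1} \<Longrightarrow> 0 \<le> poly q t"
    and qh: "\<And>t. t \<in> {-1..1} \<Longrightarrow> 0 \<le> poly (q * h) t"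
    and x: "x \<in> {-1..1}"
  shows "0 \<le> poly h x"
proof (rule ccontr)
  assume "\<not> 0 \<le> poly h x"
  then have neg: "poly h x < 0" by simp
  have "poly h \<midarrow>x\<rightarrow> poly h x" by (intro tendsto_intros)
  then obtain e where e0: "0 < e" "\<forall>t. t \<noteq> x \<and> \<bar>x - t\<bar> < e \<longrightarrow> poly h t < 0"
    using neg LIM_fun_less_zero by metis
  have e: "0 < e" "\<And>t. \<bar>t - x\<bar> < e \<Longrightarrow> poly h t < 0"
    using e0 neg by (auto simp: abs_minus_commute)
  \<comment> \<open>The neighbourhood is cut down to \<open>[-1,1]\<close> and remains a nonempty
    open interval even if \<open>x\<close> is an endpoint.\<close>
  define J where "J = {max (-1) (x - e)<..<min 1 (x + e)}"
  have "infinite J" using e(1) x by (auto simp: J_def infinite_Ioo)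
  moreover have "J \<subseteq> {t. poly q t = 0}"
  proof
    fix t assume "t \<in> J"
    then have t: "t \<in> {-1..1}" "\<bar>t - x\<bar> < e" by (auto simp: J_def)
    show "t \<in> {t. poly q t = 0}"
      using q[OF t(1)] qh[OF t(1)] e(2)[OF t(2)] by (auto simp: zero_le_mult_iff)
  qed
  ultimately show False using poly_roots_finite[OF assms(1)] finite_subset by blast
qed

section \<open>Splitting off quadratic factors\<close>

lemma map_poly_of_real_add:
  "map_poly of_real (p + q) = map_poly of_real p + (map_poly of_real q :: 'a::{real_algebra_1, comm_ring_1} poly)"
  by (rule poly_eqI) (simp add: coeff_map_poly)

lemma map_poly_of_real_mult:
  "map_poly of_real (p * q) = map_poly of_real p * (map_poly of_real q :: 'a::{real_algebra_1, comm_ring_1} poly)"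
  by (rule poly_eqI) (simp add: coeff_map_poly coeff_mult)

lemma poly_map_poly_of_real:
  "poly (map_poly complex_of_real p) (of_real x) = of_real (poly p x)"
  by (induction p) (simp_all add: map_poly_pCons)

text \<open>The quadratic is \<open>(t - z)\<close> times its conjugate. The remainder of
  \<open>h\<close> modulo it is real of degree at most one and vanishes at the non-real
  \<open>z\<close>, so it is zero.\<close>

lemma complex_root_imp_quadratic_dvd:
  fixes h :: "real poly"
  assumes z: "poly (map_poly complex_of_real h) z = 0" and "Im z \<noteq> 0"
  shows "[:(Re z)\<^sup>2 + (Im z)\<^sup>2, - 2 * Re z, 1:] dvd h"
proof -
  define q where "q = [:(Re z)\<^sup>2 + (Im z)\<^sup>2, - 2 * Re z, 1:]"
  have "degree q = 2" "q \<noteq> 0" by (auto simp: q_def)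
  then have "degree (h mod q) < 2" using degree_mod_less[of q h] by auto
  obtain c d where cd: "h mod q = [:d, c:]"
proof -
    assume *: "\<And>d c. h mod q = [:d, c:] \<Longrightarrow> thesis"
    show thesis
      by (rule *, rule poly_eqI) (use \<open>degree (h mod q) < 2\<close> in \<open>auto simp: coeff_pCons coeff_eq_0 split: nat.split\<close>)
  qed
  have "poly (map_poly complex_of_real q) z = 0"
    by (simp add: q_def map_poly_pCons complex_eq_iff power2_eq_square algebra_simps)
  moreover have "map_poly complex_of_real h =
      map_poly complex_of_real q * map_poly complex_of_real (h div q) + map_poly complex_of_real [:d, c:]"
    unfolding cd[symmetric] map_poly_of_real_mult[symmetric] map_poly_of_real_add[symmetric]
    by simp
  ultimately have "poly (map_poly complex_of_real [:d, c:]) z = 0" using z by simp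
  then have "c = 0" "d = 0"
    using assms(2) by (auto simp: map_poly_pCons complex_eq_iff)
  then show ?thesis using cd by (simp add: q_def mod_eq_0_iff_dvd)
qed

text \<open>Every non-real root or root in \<open>(-1,1)\<close> provides the factor at once;
  otherwise all roots are real and outside, and two of them are combined. Nonnegativity of
  \<open>g\<close> is left to \<open>nonneg_cofactor\<close>.\<close>

lemma interval_nonneg_split:
  fixes h :: "real poly"
  assumes nonneg: "\<And>t. t \<in> {-1..1} \<Longrightarrow> 0 \<le> poly h t" and deg: "2 \<le> degree h"
  obtains q g where "h = q * g" "degree q = 2" "interval_cert 1 q"
proof -
  have rt: "\<exists>z. poly (map_poly complex_of_real p) z = 0" if "degree p > 0" for p
  proof -
    have "\<not> constant (poly (map_poly complex_of_real p))"
      using that by (simp add: constant_degree degree_map_poly)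
    then show ?thesis by (rule fundamental_theorem_of_algebra)
  qed
  have real_root: "poly p (Re z) = 0" if "poly (map_poly complex_of_real p) z = 0" "Im z = 0" for p z
  proof -
    have "z = complex_of_real (Re z)" using that(2) by (simp add: complex_eq_iff)
    then have "poly (map_poly complex_of_real p) (complex_of_real (Re z)) = 0" using that(1) by simp
    then show ?thesis by (simp add: poly_map_poly_of_real)
  qed
  consider (complex) z where "poly (map_poly complex_of_real h) z = 0" "Im z \<noteq> 0"
    | (inner) a where "poly h a = 0" "\<bar>a\<bar> < 1"
    | (outer) "\<forall>z. poly (map_poly complex_of_real h) z = 0 \<longrightarrow> Im z = 0"
        "\<forall>a. poly h a = 0 \<longrightarrow> 1 \<le> \<bar>a\<bar>"
    by (meson not_le)
  then show thesis
  proof cases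
    case complex
    have "[:(Re z)\<^sup>2 + (Im z)\<^sup>2, - 2 * Re z, 1:] = [:- Re z, 1:]\<^sup>2 + [:Im z:]\<^sup>2"
      by (simp add: power2_eq_square)
    then have "interval_cert 1 [:(Re z)\<^sup>2 + (Im z)\<^sup>2, - 2 * Re z, 1:]"
      by (auto intro!: interval_cert.intros)
    moreover obtain g where "h = [:(Re z)\<^sup>2 + (Im z)\<^sup>2, - 2 * Re z, 1:] * g"
      using complex_root_imp_quadratic_dvd[OF complex] by (elim dvdE)
    ultimately show ?thesis by (intro that) auto
  next
    case inner
    then obtain g where g: "h = [:- a, 1:] * g"
      by (auto simp: poly_eq_0_iff_dvd elim: dvdE)
    \<comment> \<open>An interior root is a local minimum of \<open>h\<close>, so it is a multiple
      root.\<close>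
    have "poly (pderiv h) a = 0"
    proof (rule DERIV_local_min)
      show "DERIV (poly h) a :> poly (pderiv h) a" by (rule poly_DERIV)
      show "0 < 1 - \<bar>a\<bar>" using inner by simp
      show "\<forall>y. \<bar>a - y\<bar> < 1 - \<bar>a\<bar> \<longrightarrow> poly h a \<le> poly h y"
        using inner nonneg by (auto intro!: nonneg)
    qed
    then have "poly g a = 0" by (simp add: g pderiv_mult pderiv_pCons del: mult_pCons_left)
    then obtain g' where g': "g = [:- a, 1:] * g'"
      by (auto simp: poly_eq_0_iff_dvd elim: dvdE)
    show ?thesis
    proof (rule that)
      show "h = [:- a, 1:]\<^sup>2 * g'" by (simp only: g g' power2_eq_square mult.assoc)
      show "degree ([:- a, 1:]\<^sup>2) = 2" by (simp add: degree_power_eq)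
    qed (auto intro: interval_cert.square)
  next
    case outer
    obtain a where a: "poly h a = 0" using rt[of h] deg real_root outer(1)
      by (metis pos2 less_le_trans)
    then obtain g where g: "h = [:- a, 1:] * g"
      by (auto simp: poly_eq_0_iff_dvd elim: dvdE)
    have "g \<noteq> 0" using g deg by auto
    then have "degree h = 1 + degree g" unfolding g by (subst degree_mult_eq) auto
    then have "degree g > 0" using deg by simp
    then obtain z where z: "poly (map_poly complex_of_real g) z = 0" using rt by blast
    then have "poly (map_poly complex_of_real h) z = 0"
      unfolding g map_poly_of_real_mult by simp
    then have "Im z = 0" using outer(1) by blast
    then have b: "poly g (Re z) = 0" using real_root z by blast
    define b where "b = Re z"
    obtain g' where g': "g = [:- b, 1:] * g'"
      using b by (auto simp: poly_eq_0_iff_dvd b_def elim: dvdE)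
    have ab: "1 \<le> \<bar>a\<bar>" "1 \<le> \<bar>b\<bar>" using outer(2) a b by (auto simp: g b_def)
    \<comment> \<open>The sign that makes \<open>s x * (t - x)\<close> nonnegative for
      \<open>t\<close> in \<open>[-1,1]\<close>. The product of the two signs is moved into the
      cofactor, where it cancels because signs square to one.\<close>
    define s where "s = (\<lambda>x :: real. - sgn x)"
    have s: "s x * s x = 1" "0 \<le> s x * (- x) + s x" "0 \<le> s x * (- x) - s x" if "1 \<le> \<bar>x\<bar>" for x
      using that by (auto simp: s_def sgn_if abs_if split: if_splits)
    show ?thesis
    proof (rule that)
      have "[:s x * (- x), s x:] = smult (s x) [:- x, 1:]" for x by simp
      then have "[:s a * (- a), s a:] * [:s b * (- b), s b:] * smult (s a * s b) g'
          = smult ((s a * s a) * (s b * s b)) ([:- a, 1:] * ([:- b, 1:] * g'))"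
        by (simp only: mult_smult_left mult_smult_right smult_smult ac_simps)
      then show "h = ([:s a * (- a), s a:] * [:s b * (- b), s b:]) * smult (s a * s b) g'"
        using s(1) ab g g' by simp
      have "s a \<noteq> 0" "s b \<noteq> 0" using s(1)[OF ab(1)] s(1)[OF ab(2)] by auto
      then show "degree ([:s a * (- a), s a:] * [:s b * (- b), s b:]) = 2"
        by (subst degree_mult_eq) auto
      show "interval_cert 1 ([:s a * (- a), s a:] * [:s b * (- b), s b:])"
        using s(2,3) ab by (intro interval_cert_linear_mult) auto
    qed
  qed
qed

text \<open>Each quadratic factor lowers the degree by two and uses up one unit of \<open>v\<close>;
  what remains of degree at most one is settled by its values at the endpoints.\<close>

lemma Lukacs:
  assumes "\<And>t. t \<in> {-1..1} \<Longrightarrow> 0 \<le> poly h t" "degree h \<le> 2 * v"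
  shows "interval_cert v h"
  using assms
proof (induction v arbitrary: h)
  case 0
  then obtain c where "h = [:c:]" by (auto elim: degree_eq_zeroE)
  then show ?case using 0(1)[of 0] by (simp add: interval_cert_const)
next
  case (Suc v)
  show ?case
  proof (cases "2 \<le> degree h")
    case True
    then obtain q g where qg: "h = q * g" "degree q = 2" "interval_cert 1 q"
      using interval_nonneg_split Suc.prems(1) by metis
    have "g \<noteq> 0" "q \<noteq> 0" using qg True by auto
    then have "degree h = 2 + degree g" using qg by (simp add: degree_mult_eq)
    moreover have "0 \<le> poly g t" if "t \<in> {-1..1}" for t
      using nonneg_cofactor[OF \<open>q \<noteq> 0\<close> interval_cert_nonneg[OF qg(3)] _ that] Suc.prems(1) qg(1)
      by blast
    ultimately have "interval_cert v g" using Suc by simp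
    from interval_cert_mult[OF qg(3) this] show ?thesis by (simp add: qg(1))
  next
    case False
    then have "h = [:coeff h 0, coeff h 1:]"
      by (intro poly_eqI) (auto simp: coeff_pCons coeff_eq_0 split: nat.split)
    then obtain a b where ab: "h = [:a, b:]" by blast
    have "interval_cert 1 h"
      using Suc.prems(1)[of 1] Suc.prems(1)[of "-1"] unfolding ab by (intro interval_cert_linear) auto
    then show ?thesis by (rule interval_cert_mono) simp
  qed
qed

section \<open>Polynomials in several variables and Gram matrices\<close>

lemma exp_deg_add: "exp_deg (\<alpha> + \<beta>) = exp_deg \<alpha> + exp_deg \<beta>"
  by (simp add: exp_deg_def lookup_add sum.distrib)

lemma exp_deg_zero [simp]: "exp_deg 0 = 0"
  by (simp add: exp_deg_def)

lemma exp_deg_single: "exp_deg (Poly_Mapping.single i k) = k"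
  by (simp add: exp_deg_def lookup_single when_def)

lemma finite_exps_upto [simp]: "finite (exps_upto r :: 'n::finite exponent set)"
proof -
  have "Poly_Mapping.lookup \<alpha> i \<le> exp_deg \<alpha>" for \<alpha> :: "'n exponent" and i
    unfolding exp_deg_def by (rule member_le_sum) auto
  then have "Poly_Mapping.lookup ` (exps_upto r :: 'n exponent set) \<subseteq> PiE UNIV (\<lambda>_. {..r})"
    by (auto simp: exps_upto_def intro: order.trans)
  then have "finite (Poly_Mapping.lookup ` (exps_upto r :: 'n exponent set))"
    by (rule finite_subset) (auto intro: finite_PiE)
  then show ?thesis
    by (rule finite_imageD) (auto simp: inj_on_def intro: poly_mapping_eqI)
qed

lemma exps_upto_add: "\<alpha> \<in> exps_upto r \<Longrightarrow> \<beta> \<in> exps_upto s \<Longrightarrow> \<alpha> + \<beta> \<in> exps_upto (r + s)"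
  by (simp add: exps_upto_def exp_deg_add)

text \<open>Variables are moved one at a time from \<open>\<gamma>\<close> to the first factor. This
  shows that products of two monomials of degree at most \<open>s\<close> exhaust those of degree at
  most \<open>2 * s\<close>.\<close>

lemma exps_upto_split:
  "exp_deg \<gamma> \<le> s + t \<Longrightarrow> \<exists>\<alpha> \<beta>. \<gamma> = \<alpha> + \<beta> \<and> exp_deg \<alpha> \<le> s \<and> exp_deg \<beta> \<le> t"
proof (induction s arbitrary: \<gamma>)
  case 0
  then show ?case by (intro exI[of _ 0] exI[of _ \<gamma>]) simp
next
  case (Suc s)
  show ?case
  proof (cases "exp_deg \<gamma> \<le> s + t")
    case True
    then show ?thesis using Suc.IH le_SucI by blast
  next
    case False
    then have "exp_deg \<gamma> \<noteq> 0" by simp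
    then obtain i where i: "Poly_Mapping.lookup \<gamma> i \<noteq> 0"
      unfolding exp_deg_def by (meson sum.neutral)
    define \<gamma>' where "\<gamma>' = \<gamma> - Poly_Mapping.single i 1"
    have \<gamma>: "\<gamma> = Poly_Mapping.single i 1 + \<gamma>'"
      using i by (intro poly_mapping_eqI)
        (auto simp: \<gamma>'_def lookup_add lookup_minus lookup_single when_def)
    then have "exp_deg \<gamma> = 1 + exp_deg \<gamma>'"
      by (simp add: exp_deg_add exp_deg_single)
    then obtain \<alpha> \<beta> where "\<gamma>' = \<alpha> + \<beta>" "exp_deg \<alpha> \<le> s" "exp_deg \<beta> \<le> t"
      using Suc by fastforce
    then show ?thesis
      by (intro exI[of _ "Poly_Mapping.single i 1 + \<alpha>"] exI[of _ \<beta>])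
        (simp add: \<gamma> exp_deg_add exp_deg_single add.assoc)
  qed
qed

text \<open>Turns degree bounds into inclusions of supports, with the zero polynomial fitting in
  without a special case.\<close>

lemma total_deg_le_iff: "total_deg p \<le> d \<longleftrightarrow> Poly_Mapping.keys p \<subseteq> exps_upto d"
  by (auto simp: total_deg_def exps_upto_def)

lemma total_deg_add: "total_deg p \<le> d \<Longrightarrow> total_deg q \<le> d \<Longrightarrow> total_deg (p + q) \<le> d"
  using keys_add[of p q] by (auto simp: total_deg_le_iff)

lemma total_deg_diff: "total_deg p \<le> d \<Longrightarrow> total_deg q \<le> d \<Longrightarrow> total_deg (p - q) \<le> d"
  using keys_diff[of p q] by (fastforce simp: total_deg_le_iff)

lemma total_deg_sum: "(\<And>i. i \<in> I \<Longrightarrow> total_deg (p i) \<le> d) \<Longrightarrow> total_deg (\<Sum>i\<in>I. p i) \<le> d"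
  using keys_sum[of p I] by (fastforce simp: total_deg_le_iff)

lemma total_deg_mult: "total_deg p \<le> d \<Longrightarrow> total_deg q \<le> e \<Longrightarrow> total_deg (p * q) \<le> d + e"
  using keys_mult[of p q] exps_upto_add by (fastforce simp: total_deg_le_iff)

lemma total_deg_const_poly [simp]: "total_deg (const_poly c) \<le> d"
  by (simp add: total_deg_le_iff const_poly_def exps_upto_def)

lemma total_deg_xpow: "\<alpha> \<in> exps_upto d \<Longrightarrow> total_deg (xpow \<alpha>) \<le> d"
  by (simp add: total_deg_le_iff xpow_def)

lemma total_deg_xvar: "total_deg (xvar i) \<le> 1"
  unfolding xvar_def by (rule total_deg_xpow) (simp add: exps_upto_def exp_deg_single)

lemma coef_zero [simp]: "coef 0 \<alpha> = 0" by (simp add: coef_def)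
lemma coef_add: "coef (p + q) \<alpha> = coef p \<alpha> + coef q \<alpha>" by (simp add: coef_def lookup_add)
lemma coef_sum: "coef (\<Sum>i\<in>I. p i) \<alpha> = (\<Sum>i\<in>I. coef (p i) \<alpha>)" by (simp add: coef_def lookup_sum)

lemma coef_const_mult: "coef (const_poly c * p) \<alpha> = c * coef p \<alpha>"
  unfolding coef_def const_poly_def mult_map_scale_conv_mult[symmetric]
  by (simp add: map.rep_eq when_def)

lemma coef_xpow: "coef (xpow \<alpha>) \<beta> = (if \<alpha> = \<beta> then 1 else 0)"
  by (simp add: coef_def xpow_def lookup_single when_def)

lemma mpoly_eqI: "(\<And>\<alpha>. coef p \<alpha> = coef q \<alpha>) \<Longrightarrow> p = q"
  unfolding coef_def by (rule poly_mapping_eqI)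

lemma coef_eq_zero: "Poly_Mapping.keys p \<subseteq> S \<Longrightarrow> \<alpha> \<notin> S \<Longrightarrow> coef p \<alpha> = 0"
  by (auto simp: coef_def in_keys_iff)

lemma xpow_add: "xpow (\<alpha> + \<beta>) = xpow \<alpha> * xpow \<beta>"
  by (simp add: xpow_def mult_single)

lemma const_poly_add: "const_poly (a + b) = const_poly a + const_poly b"
  by (simp add: const_poly_def single_add)

lemma const_poly_mult: "const_poly (a * b) = const_poly a * const_poly b"
  by (simp add: const_poly_def mult_single)

lemma const_poly_zero [simp]: "const_poly 0 = 0" by (simp add: const_poly_def)
lemma const_poly_one [simp]: "const_poly 1 = 1" by (simp add: const_poly_def)

lemma const_poly_uminus: "const_poly (- a) = - const_poly a"
  by (simp add: const_poly_def single_uminus)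

lemma mpoly_expansion:
  assumes "finite S" "Poly_Mapping.keys p \<subseteq> S"
  shows "p = (\<Sum>\<alpha>\<in>S. const_poly (coef p \<alpha>) * xpow \<alpha>)"
proof (rule mpoly_eqI)
  fix \<beta>
  have "coef (\<Sum>\<alpha>\<in>S. const_poly (coef p \<alpha>) * xpow \<alpha>) \<beta> = (if \<beta> \<in> S then coef p \<beta> else 0)"
    using assms(1) by (simp add: coef_sum coef_const_mult coef_xpow if_distrib[of "\<lambda>x. _ * x"] cong: if_cong)
  then show "coef p \<beta> = coef (\<Sum>\<alpha>\<in>S. const_poly (coef p \<alpha>) * xpow \<alpha>) \<beta>"
    using coef_eq_zero[OF assms(2)] by simp
qed

section \<open>Pairings of real matrices with polynomial matrices\<close>

lemma pairing_cong:
  "(\<And>i j. i \<in> I \<Longrightarrow> j \<in> I \<Longrightarrow> A i j = B i j) \<Longrightarrow> pairing I A M = pairing I B M"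
  unfolding pairing_def by (intro sum.cong) auto

lemma pairing_zero [simp]: "pairing I (\<lambda>i j. 0) M = 0"
  by (simp add: pairing_def)

lemma pairing_add:
  "pairing I (\<lambda>i j. A i j + B i j) M = pairing I A M + pairing I B M"
  by (simp add: pairing_def const_poly_add distrib_right sum.distrib)

lemma pairing_sum:
  "pairing I (\<lambda>i j. \<Sum>k\<in>K. A k i j) M = (\<Sum>k\<in>K. pairing I (A k) M)"
  by (induction K rule: infinite_finite_induct) (simp_all add: pairing_add)

lemma pairing_mult_left: "pairing I A (\<lambda>i j. g * M i j) = g * pairing I A M"
  by (simp add: pairing_def sum_distrib_left mult.left_commute)

lemma pairing_unit:
  assumes "finite I" "a \<in> I" "b \<in> I"
  shows "pairing I (\<lambda>i j. if i = a \<and> j = b then c else 0) M = const_poly c * M a b"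
proof -
  have "pairing I (\<lambda>i j. if i = a \<and> j = b then c else 0) M
      = (\<Sum>j\<in>I. if j = b then (\<Sum>i\<in>I. if i = a then const_poly c * M a b else 0) else 0)"
    unfolding pairing_def by (intro sum.cong refl) (auto intro!: sum.cong)
  also have "\<dots> = const_poly c * M a b" using assms by simp
  finally show ?thesis .
qed

lemma pairing_rank_one:
  "pairing I (\<lambda>i j. u i * u j) (\<lambda>\<alpha> \<beta>. xpow \<alpha> * xpow \<beta>) = (\<Sum>\<alpha>\<in>I. const_poly (u \<alpha>) * xpow \<alpha>)\<^sup>2"
  unfolding pairing_def power2_eq_square sum_product
  by (intro sum.cong refl) (simp add: const_poly_mult ac_simps)

lemma total_deg_pairing:
  assumes "\<And>i j. i \<in> I \<Longrightarrow> j \<in> I \<Longrightarrow> total_deg (M i j) \<le> d"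
  shows "total_deg (pairing I A M) \<le> d"
  unfolding pairing_def
proof (intro total_deg_sum)
  fix i j assume "j \<in> I" "i \<in> I"
  with assms show "total_deg (const_poly (A i j) * M i j) \<le> d"
    using total_deg_mult[OF total_deg_const_poly[of _ 0], of "M i j" d] by simp
qed

lemma total_deg_pairing_xpow:
  "total_deg (pairing (exps_upto s) A (\<lambda>\<alpha> \<beta>. xpow \<alpha> * xpow \<beta>)) \<le> 2 * s"
  by (rule total_deg_pairing) (auto intro!: total_deg_mult total_deg_xpow simp: mult_2)

section \<open>Sums of squares and Gram matrices\<close>

text \<open>If \<open>\<alpha>\<close> has maximal degree among all exponents of the \<open>q\<close> and, subject to that, maximal
  Euclidean norm, then it is the midpoint of no other two exponents, so the coefficient of
  \<open>2\<alpha>\<close> in the sum of squares is the sum of the squares of the coefficients of \<open>\<alpha>\<close>.\<close>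

lemma sum_of_squares_degree:
  fixes qs :: "'n::finite mpoly list"
  assumes deg: "total_deg (\<Sum>q\<leftarrow>qs. q\<^sup>2) \<le> 2 * r" and q0: "q0 \<in> set qs"
  shows "total_deg q0 \<le> r"
proof -
  define K where "K = (\<Union>q\<in>set qs. Poly_Mapping.keys q)"
  have K: "finite K" "\<And>q. q \<in> set qs \<Longrightarrow> Poly_Mapping.keys q \<subseteq> K" by (auto simp: K_def)
  show ?thesis
  proof (cases "K = {}")
    case True
    then show ?thesis using K(2)[OF q0] by (simp add: total_deg_le_iff)
  next
    case False
    define D where "D = Max (exp_deg ` K)"
    have D: "exp_deg \<beta> \<le> D" if "\<beta> \<in> K" for \<beta> using that K(1) by (simp add: D_def)
    define K' where "K' = {\<beta> \<in> K. exp_deg \<beta> = D}"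
    have "D \<in> exp_deg ` K" unfolding D_def using K(1) False by (intro Max_in) auto
    then have K': "finite K'" "K' \<noteq> {}" using K(1) by (auto simp: K'_def)
    define N where "N = (\<lambda>\<beta> :: 'n exponent. \<Sum>i\<in>UNIV. (real (Poly_Mapping.lookup \<beta> i))\<^sup>2)"
    have "Max (N ` K') \<in> N ` K'" using K' by (intro Max_in) auto
    then obtain \<alpha> where \<alpha>: "\<alpha> \<in> K'" "N \<alpha> = Max (N ` K')" by auto
    have N: "N \<beta> \<le> N \<alpha>" if "\<beta> \<in> K'" for \<beta> using that K'(1) by (simp add: \<alpha>(2))
    have mid: "\<beta> = \<alpha> \<and> \<gamma> = \<alpha>" if "\<beta> \<in> K" "\<gamma> \<in> K" and eq: "\<beta> + \<gamma> = \<alpha> + \<alpha>" for \<beta> \<gamma>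
    proof -
      have "exp_deg \<beta> + exp_deg \<gamma> = 2 * D"
        using arg_cong[OF eq, of exp_deg] \<alpha>(1) by (simp add: exp_deg_add K'_def)
      then have "\<beta> \<in> K'" "\<gamma> \<in> K'" using that D[of \<beta>] D[of \<gamma>] by (auto simp: K'_def)
      then have le: "N \<beta> + N \<gamma> \<le> 2 * N \<alpha>" using N[of \<beta>] N[of \<gamma>] by linarith
      have l: "Poly_Mapping.lookup \<beta> i + Poly_Mapping.lookup \<gamma> i = 2 * Poly_Mapping.lookup \<alpha> i" for i
        using arg_cong[OF eq, of "\<lambda>x. Poly_Mapping.lookup x i"] by (simp add: lookup_add)
      \<comment> \<open>The parallelogram law: summed over \<open>i\<close>, it bounds the squared
        distance of \<beta> and \<gamma> by zero, as the norm of \<alpha> is maximal.\<close>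
      have "(real (Poly_Mapping.lookup \<beta> i) - real (Poly_Mapping.lookup \<gamma> i))\<^sup>2 =
          2 * (real (Poly_Mapping.lookup \<beta> i))\<^sup>2 + 2 * (real (Poly_Mapping.lookup \<gamma> i))\<^sup>2
          - 4 * (real (Poly_Mapping.lookup \<alpha> i))\<^sup>2" for i
      proof -
        have "real (Poly_Mapping.lookup \<alpha> i) =
            (real (Poly_Mapping.lookup \<beta> i) + real (Poly_Mapping.lookup \<gamma> i)) / 2"
          using arg_cong[OF l[of i], of real] by simp
        then show ?thesis by (simp add: power2_eq_square algebra_simps add_divide_distrib)
      qed
      then have "(\<Sum>i\<in>UNIV. (real (Poly_Mapping.lookup \<beta> i) - real (Poly_Mapping.lookup \<gamma> i))\<^sup>2)
          = 2 * N \<beta> + 2 * N \<gamma> - 4 * N \<alpha>"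
        by (simp add: N_def sum.distrib sum_subtractf sum_distrib_left)
      also have "\<dots> \<le> 0" using le by simp
      finally have "(\<Sum>i\<in>UNIV. (real (Poly_Mapping.lookup \<beta> i) - real (Poly_Mapping.lookup \<gamma> i))\<^sup>2) = 0"
        by (intro antisym sum_nonneg) auto
      then have "Poly_Mapping.lookup \<beta> i = Poly_Mapping.lookup \<gamma> i" for i
        by (subst (asm) sum_nonneg_eq_0_iff) auto
      then have "Poly_Mapping.lookup \<beta> i = Poly_Mapping.lookup \<alpha> i \<and>
        Poly_Mapping.lookup \<gamma> i = Poly_Mapping.lookup \<alpha> i" for i
        using l[of i] by (metis mult_2 nat_mult_eq_cancel1 zero_less_numeral)
      then show ?thesis by (auto intro: poly_mapping_eqI)
    qed
    have sq: "coef (q\<^sup>2) (\<alpha> + \<alpha>) = (coef q \<alpha>)\<^sup>2" if "q \<in> set qs" for q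
    proof -
      have "q\<^sup>2 = (\<Sum>\<beta>\<in>K. \<Sum>\<gamma>\<in>K. const_poly (coef q \<beta> * coef q \<gamma>) * xpow (\<beta> + \<gamma>))"
      proof -
        have "q\<^sup>2 = (\<Sum>\<alpha>\<in>K. const_poly (coef q \<alpha>) * xpow \<alpha>)\<^sup>2"
          by (rule arg_cong[OF mpoly_expansion[OF K(1) K(2)[OF that]]])
        also have "\<dots> = (\<Sum>\<beta>\<in>K. \<Sum>\<gamma>\<in>K. const_poly (coef q \<beta> * coef q \<gamma>) * xpow (\<beta> + \<gamma>))"
          unfolding power2_eq_square sum_product
          by (intro sum.cong refl) (simp only: const_poly_mult xpow_add ac_simps)
        finally show ?thesis .
      qed
      then have "coef (q\<^sup>2) (\<alpha> + \<alpha>) =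
          (\<Sum>\<beta>\<in>K. \<Sum>\<gamma>\<in>K. coef q \<beta> * coef q \<gamma> * (if \<beta> + \<gamma> = \<alpha> + \<alpha> then 1 else 0))"
        by (simp add: coef_sum coef_const_mult coef_xpow)
      also have "\<dots> = (\<Sum>\<beta>\<in>K. \<Sum>\<gamma>\<in>K. if \<gamma> = \<alpha> then if \<beta> = \<alpha> then (coef q \<alpha>)\<^sup>2 else 0 else 0)"
      proof (intro sum.cong refl)
        fix \<beta> \<gamma> assume "\<beta> \<in> K" "\<gamma> \<in> K"
        from mid[OF this] have "\<beta> + \<gamma> = \<alpha> + \<alpha> \<longleftrightarrow> \<beta> = \<alpha> \<and> \<gamma> = \<alpha>" by blast
        then show "coef q \<beta> * coef q \<gamma> * (if \<beta> + \<gamma> = \<alpha> + \<alpha> then 1 else 0) =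
            (if \<gamma> = \<alpha> then if \<beta> = \<alpha> then (coef q \<alpha>)\<^sup>2 else 0 else 0)"
          by (simp add: power2_eq_square)
      qed
      also have "\<dots> = (coef q \<alpha>)\<^sup>2" using K(1) \<alpha>(1) by (simp add: K'_def)
      finally show ?thesis .
    qed
    obtain q1 where q1: "q1 \<in> set qs" "\<alpha> \<in> Poly_Mapping.keys q1"
      using \<alpha>(1) by (auto simp: K'_def K_def)
    have coef_list: "coef (\<Sum>q\<leftarrow>ps. q\<^sup>2) \<beta> = (\<Sum>q\<leftarrow>ps. coef (q\<^sup>2) \<beta>)" for ps :: "'n mpoly list" and \<beta>
      by (induction ps) (simp_all add: coef_add)
    \<comment> \<open>One positive square keeps the coefficient of
      \<open>\<alpha> + \<alpha>\<close> from vanishing, so \<open>2 * D\<close> is at most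
      \<open>2 * r\<close>.\<close>
    have "(coef q1 \<alpha>)\<^sup>2 \<le> (\<Sum>q\<leftarrow>qs. (coef q \<alpha>)\<^sup>2)"
      using q1(1) by (intro member_le_sum_list) auto
    also have "\<dots> = coef (\<Sum>q\<leftarrow>qs. q\<^sup>2) (\<alpha> + \<alpha>)"
      unfolding coef_list by (intro arg_cong[of _ _ sum_list] map_cong) (simp_all add: sq)
    finally have "coef (\<Sum>q\<leftarrow>qs. q\<^sup>2) (\<alpha> + \<alpha>) \<noteq> 0"
      using q1(2) by (auto simp: coef_def in_keys_iff)
    then have "\<alpha> + \<alpha> \<in> exps_upto (2 * r)"
      using deg coef_eq_zero by (metis total_deg_le_iff)
    then have "D \<le> r" using \<alpha>(1) by (simp add: exps_upto_def exp_deg_add K'_def)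
    then show ?thesis using K(2)[OF q0] D by (fastforce simp: total_deg_le_iff exps_upto_def)
  qed
qed

text \<open>By \<open>sum_of_squares_degree\<close> every square is that of a polynomial of degree
  at most \<open>r\<close>, whose coefficient vector gives a rank one Gram matrix; these are added
  up.\<close>

lemma sum_of_squares_imp_psd:
  assumes "sum_of_squares p" "total_deg p \<le> 2 * r"
  shows "\<exists>X. psd_on (exps_upto r) X \<and> p = pairing (exps_upto r) X (\<lambda>\<alpha> \<beta>. xpow \<alpha> * xpow \<beta>)"
proof -
  obtain qs where p: "p = (\<Sum>q\<leftarrow>qs. q\<^sup>2)" using assms(1) by (auto simp: sum_of_squares_def)
  have deg: "\<forall>q\<in>set qs. total_deg q \<le> r" using sum_of_squares_degree assms(2) p by blast
  then show ?thesis unfolding p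
  proof (induction qs)
    case Nil
    show ?case using psd_on_zero pairing_zero by fastforce
  next
    case (Cons q qs)
    then obtain X where X: "psd_on (exps_upto r) X"
      "(\<Sum>q\<leftarrow>qs. q\<^sup>2) = pairing (exps_upto r) X (\<lambda>\<alpha> \<beta>. xpow \<alpha> * xpow \<beta>)" by auto
    have "q = (\<Sum>\<alpha>\<in>exps_upto r. const_poly (coef q \<alpha>) * xpow \<alpha>)"
      using Cons.prems by (intro mpoly_expansion) (auto simp: total_deg_le_iff)
    then have "q\<^sup>2 = pairing (exps_upto r) (\<lambda>\<alpha> \<beta>. coef q \<alpha> * coef q \<beta>) (\<lambda>\<alpha> \<beta>. xpow \<alpha> * xpow \<beta>)"
      unfolding pairing_rank_one by (rule arg_cong)
    then show ?case using X psd_on_add[OF psd_on_rank_one[of _ "coef q"] X(1)]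
      by (auto simp: pairing_add[symmetric])
  qed
qed

lemma psd_imp_sum_of_squares:
  assumes "psd_on (exps_upto r) X"
  shows "sum_of_squares (pairing (exps_upto r) X (\<lambda>\<alpha> \<beta>. xpow \<alpha> * xpow \<beta>))"
proof -
  obtain ws where ws: "\<And>i j. i \<in> exps_upto r \<Longrightarrow> j \<in> exps_upto r \<Longrightarrow> X i j = (\<Sum>w\<leftarrow>ws. w i * w j)"
    using psd_on_imp_Gram[OF finite_exps_upto assms] by blast
  have "pairing (exps_upto r) (\<lambda>i j. \<Sum>w\<leftarrow>ws. w i * w j) (\<lambda>\<alpha> \<beta>. xpow \<alpha> * xpow \<beta>)
      = (\<Sum>w\<leftarrow>ws. (\<Sum>\<alpha>\<in>exps_upto r. const_poly (w \<alpha>) * xpow \<alpha>)\<^sup>2)" for ws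
    by (induction ws) (simp_all add: pairing_add pairing_rank_one)
  then have "pairing (exps_upto r) X (\<lambda>\<alpha> \<beta>. xpow \<alpha> * xpow \<beta>)
      = (\<Sum>q\<leftarrow>map (\<lambda>w. \<Sum>\<alpha>\<in>exps_upto r. const_poly (w \<alpha>) * xpow \<alpha>) ws. q\<^sup>2)"
    using ws by (subst pairing_cong[OF ws]) (simp_all add: o_def)
  then show ?thesis unfolding sum_of_squares_def by blast
qed

text \<open>Used for the free multipliers of the equations of the cube. It is enough to represent
  one term at a time and to add the matrices.\<close>

lemma symmetric_Gram_exists:
  assumes "total_deg p \<le> 2 * s"
  shows "\<exists>A. sym_on (exps_upto s) A \<and> p = pairing (exps_upto s) A (\<lambda>\<alpha> \<beta>. xpow \<alpha> * xpow \<beta>)"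
proof -
  have "\<exists>A. sym_on (exps_upto s) A \<and>
      const_poly c * xpow \<gamma> = pairing (exps_upto s) A (\<lambda>\<alpha> \<beta>. xpow \<alpha> * xpow \<beta>)"
    if \<gamma>: "\<gamma> \<in> exps_upto (2 * s)" for \<gamma> :: "'a exponent" and c
  proof -
    obtain a b where ab: "\<gamma> = a + b" "a \<in> exps_upto s" "b \<in> exps_upto s"
      using exps_upto_split[of \<gamma> s s] \<gamma> by (auto simp: exps_upto_def mult_2)
    \<comment> \<open>Written as a sum of two matrices so that for \<open>a = b\<close> both halves
      fall on the same entry and add up to \<open>c\<close>.\<close>
    let ?A = "\<lambda>i j. (if i = a \<and> j = b then c / 2 else 0) + (if i = b \<and> j = a then c / 2 else 0)"
    have "pairing (exps_upto s) ?A (\<lambda>\<alpha> \<beta>. xpow \<alpha> * xpow \<beta>)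
        = const_poly (c / 2) * xpow \<gamma> + const_poly (c / 2) * xpow \<gamma>"
      using ab by (simp add: pairing_add pairing_unit xpow_add mult.commute)
    also have "\<dots> = const_poly c * xpow \<gamma>"
      unfolding distrib_right[symmetric] const_poly_add[symmetric] by simp
    finally have "const_poly c * xpow \<gamma> = pairing (exps_upto s) ?A (\<lambda>\<alpha> \<beta>. xpow \<alpha> * xpow \<beta>)"
      by (rule sym)
    moreover have "sym_on (exps_upto s) ?A"
      unfolding sym_on_def by (intro ballI, subst add.commute) (simp only: conj_commute)
    ultimately show ?thesis by blast
  qed
  then have "\<forall>\<gamma>\<in>exps_upto (2 * s). \<exists>A. sym_on (exps_upto s) A \<and>
      const_poly (coef p \<gamma>) * xpow \<gamma> = pairing (exps_upto s) A (\<lambda>\<alpha> \<beta>. xpow \<alpha> * xpow \<beta>)"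
    by blast
  from bchoice[OF this] obtain A where A: "\<And>\<gamma>. \<gamma> \<in> exps_upto (2 * s) \<Longrightarrow> sym_on (exps_upto s) (A \<gamma>)"
      "\<And>\<gamma>. \<gamma> \<in> exps_upto (2 * s) \<Longrightarrow>
        const_poly (coef p \<gamma>) * xpow \<gamma> = pairing (exps_upto s) (A \<gamma>) (\<lambda>\<alpha> \<beta>. xpow \<alpha> * xpow \<beta>)"
    by blast
  have "p = (\<Sum>\<gamma>\<in>exps_upto (2 * s). const_poly (coef p \<gamma>) * xpow \<gamma>)"
    using assms by (intro mpoly_expansion) (simp_all add: total_deg_le_iff)
  also have "\<dots> = pairing (exps_upto s) (\<lambda>i j. \<Sum>\<gamma>\<in>exps_upto (2 * s). A \<gamma> i j)
      (\<lambda>\<alpha> \<beta>. xpow \<alpha> * xpow \<beta>)"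
    unfolding pairing_sum by (intro sum.cong refl A(2))
  moreover have "sym_on (exps_upto s) (\<lambda>i j. \<Sum>\<gamma>\<in>exps_upto (2 * s). A \<gamma> i j)"
    using A(1) unfolding sym_on_def by (intro ballI sum.cong refl) blast
  ultimately show ?thesis by auto
qed

section \<open>Powers of polynomial matrices\<close>

lemma mat_pow_zero [simp]: "mat_pow A 0 = mat 1"
  by (simp add: mat_pow_def)

lemma mat_pow_Suc: "mat_pow A (Suc k) = A ** mat_pow A k"
  by (simp add: mat_pow_def)

lemma mat_pow_Suc2: "mat_pow (A :: 'a::comm_ring_1^'m^'m) (Suc k) = mat_pow A k ** A"
proof (induction k)
  case 0
  show ?case by (simp add: mat_pow_Suc)
next
  case (Suc k)
  have "mat_pow A (Suc (Suc k)) = A ** (mat_pow A k ** A)" by (simp add: mat_pow_Suc[of A "Suc k"] Suc)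
  also have "\<dots> = mat_pow A (Suc k) ** A" by (simp add: mat_pow_Suc matrix_mul_assoc)
  finally show ?case .
qed

lemma total_deg_entry: "total_deg (G $ a $ b) \<le> mat_deg G"
proof -
  have "{total_deg (G $ a $ b) | a b. True} = (\<lambda>(a, b). total_deg (G $ a $ b)) ` UNIV" by auto
  then have "finite {total_deg (G $ a $ b) | a b. True}" by (simp only: finite_imageI finite)
  then show ?thesis unfolding mat_deg_def by (intro Max_ge) auto
qed

lemma total_deg_mat_pow:
  fixes G :: "('n::finite mpoly)^'m^'m"
  shows "total_deg (mat_pow G k $ a $ b) \<le> k * mat_deg G"
proof (induction k arbitrary: a b)
  case 0
  have "(mat 1 :: ('n mpoly)^'m^'m) $ a $ b = const_poly (if a = b then 1 else 0)" by (simp add: mat_def)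
  then show ?case by (simp only: mat_pow_zero mult_0 total_deg_const_poly)
next
  case (Suc k)
  then show ?case
    by (auto simp: mat_pow_Suc matrix_matrix_mult_def intro!: total_deg_sum total_deg_mult total_deg_entry)
qed

section \<open>The linear map sending \<open>t ^ i\<close> to the trace of the power
  \<open>i + 1\<close> of \<open>G\<close>\<close>

definition trace_form :: "('n::finite mpoly)^'m^'m \<Rightarrow> real poly \<Rightarrow> 'n mpoly" where
  "trace_form G h = (\<Sum>i\<le>degree h. const_poly (coeff h i) * trace (mat_pow G (Suc i)))"

text \<open>Symmetry of \<open>G\<close> turns the entrywise inner product into the trace of
  \<open>h(G) G\<close>, so that every power of \<open>G\<close> is raised by one.\<close>

lemma trace_poly_at_mat:
  fixes G :: "('n::finite mpoly)^'m^'m"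
  assumes "transpose G = G"
  shows "trace (transpose (poly_at_mat h G) ** G) = trace_form G h"
proof -
  have G: "G $ b $ a = G $ a $ b" for a b
    using arg_cong[OF assms, of "\<lambda>M. M $ a $ b"] by (simp add: transpose_def)
  have "trace (transpose (poly_at_mat h G) ** G) =
      (\<Sum>a\<in>UNIV. \<Sum>b\<in>UNIV. \<Sum>i\<le>degree h. const_poly (coeff h i) * (mat_pow G i $ b $ a * G $ a $ b))"
    by (simp add: trace_def transpose_def matrix_matrix_mult_def poly_at_mat_def sum_distrib_right
        mult.assoc G)
  also have "\<dots> = (\<Sum>b\<in>UNIV. \<Sum>a\<in>UNIV. \<Sum>i\<le>degree h. const_poly (coeff h i) * (mat_pow G i $ b $ a * G $ a $ b))"
    by (rule sum.swap)
  also have "\<dots> = (\<Sum>b\<in>UNIV. \<Sum>i\<le>degree h. \<Sum>a\<in>UNIV. const_poly (coeff h i) * (mat_pow G i $ b $ a * G $ a $ b))"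
    by (intro sum.cong refl sum.swap)
  also have "\<dots> = (\<Sum>i\<le>degree h. \<Sum>b\<in>UNIV. \<Sum>a\<in>UNIV. const_poly (coeff h i) * (mat_pow G i $ b $ a * G $ a $ b))"
    by (rule sum.swap)
  also have "\<dots> = trace_form G h"
    by (simp add: trace_form_def mat_pow_Suc2 trace_def matrix_matrix_mult_def sum_distrib_left)
  finally show ?thesis .
qed

lemma trace_form_eq:
  assumes "degree h \<le> N"
  shows "trace_form G h = (\<Sum>i\<le>N. const_poly (coeff h i) * trace (mat_pow G (Suc i)))"
  unfolding trace_form_def using assms
  by (intro sum.mono_neutral_left) (auto simp: coeff_eq_0)

lemma trace_form_add: "trace_form G (p + q) = trace_form G p + trace_form G q"
proof -
  let ?N = "max (degree p) (degree q)"
  show ?thesis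
    by (simp add: trace_form_eq[of "p + q" ?N] trace_form_eq[of p ?N] trace_form_eq[of q ?N]
        degree_add_le_max const_poly_add distrib_right sum.distrib)
qed

lemma trace_form_zero [simp]: "trace_form G 0 = 0"
  by (simp add: trace_form_def)

lemma trace_form_sum: "trace_form G (\<Sum>i\<in>I. p i) = (\<Sum>i\<in>I. trace_form G (p i))"
  by (induction I rule: infinite_finite_induct) (simp_all add: trace_form_add)

lemma trace_form_monom: "trace_form G (monom c n) = const_poly c * trace (mat_pow G (Suc n))"
proof -
  have "trace_form G (monom c n) = (\<Sum>i\<le>n. if i = n then const_poly c * trace (mat_pow G (Suc n)) else 0)"
    unfolding trace_form_eq[OF degree_monom_le] by (intro sum.cong refl) auto
  then show ?thesis by simp
qed

lemma total_deg_trace_form: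
  assumes "degree h \<le> k"
  shows "total_deg (trace_form G h) \<le> (k + 1) * mat_deg G"
  unfolding trace_form_eq[OF assms]
proof (rule total_deg_sum)
  fix i assume "i \<in> {..k}"
  then have "Suc i * mat_deg G \<le> (k + 1) * mat_deg G" by (intro mult_right_mono) auto
  moreover have "total_deg (const_poly (coeff h i) * trace (mat_pow G (Suc i))) \<le> 0 + Suc i * mat_deg G"
    unfolding trace_def by (intro total_deg_mult total_deg_sum total_deg_mat_pow total_deg_const_poly)
  ultimately show "total_deg (const_poly (coeff h i) * trace (mat_pow G (Suc i))) \<le> (k + 1) * mat_deg G"
    by (simp only: add_0)
qed

text \<open>The quadratic form of \<open>Y\<close> at the monomial vector
  \<open>(1, t, ..., t\<^sup>v)\<close>.\<close>

definition gram_poly :: "nat \<Rightarrow> (nat \<Rightarrow> nat \<Rightarrow> real) \<Rightarrow> real poly" where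
  "gram_poly v Y = (\<Sum>j\<le>v. \<Sum>i\<le>v. monom (Y i j) (i + j))"

lemma gram_poly_add: "gram_poly v (\<lambda>i j. A i j + B i j) = gram_poly v A + gram_poly v B"
  by (simp add: gram_poly_def add_monom[symmetric] sum.distrib)

lemma gram_poly_zero [simp]: "gram_poly v (\<lambda>i j. 0) = 0"
  by (simp add: gram_poly_def)

lemma degree_gram_poly: "degree (gram_poly v Y) \<le> 2 * v"
  unfolding gram_poly_def
  by (intro degree_sum_le finite_atMost order.trans[OF degree_monom_le]) auto

lemma poly_gram_poly_nonneg:
  assumes "psd_on {..v} Y"
  shows "0 \<le> poly (gram_poly v Y) t"
proof -
  have "poly (gram_poly v Y) t = (\<Sum>i\<le>v. \<Sum>j\<le>v. t ^ i * Y i j * t ^ j)"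
    by (subst sum.swap) (simp add: gram_poly_def poly_sum poly_monom power_add ac_simps)
  then show ?thesis using psd_onD[OF assms] by simp
qed

lemma gram_poly_rank_one:
  assumes "degree q \<le> v"
  shows "gram_poly v (\<lambda>i j. coeff q i * coeff q j) = q\<^sup>2"
proof -
  have "q\<^sup>2 = (\<Sum>i\<le>v. monom (coeff q i) i)\<^sup>2"
    using poly_as_sum_of_monoms'[OF assms] by simp
  then show ?thesis
    by (simp add: gram_poly_def power2_eq_square sum_product mult_monom ac_simps)
qed

text \<open>Generators correspond to rank one matrices in one of the two blocks. For
  \<open>v = 0\<close> the second block still has size one because of the truncated
  \<open>v - 1\<close>, and it is filled with zero.\<close>

lemma interval_cert_imp_gram_poly:
  assumes "interval_cert v h"
  shows "\<exists>Y Z. psd_on {..v} Y \<and> psd_on {..v - 1} Z \<and>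
    h = gram_poly v Y + [:1, 0, -1:] * gram_poly (v - 1) Z"
  using assms
proof (induction rule: interval_cert.induct)
  case (zero v)
  show ?case by (intro exI[of _ "\<lambda>i j. 0"] conjI psd_on_zero) simp
next
  case (square q v)
  show ?case
    by (intro exI[of _ "\<lambda>i j. coeff q i * coeff q j"] exI[of _ "\<lambda>i j. 0"] conjI psd_on_zero psd_on_rank_one)
      (simp add: gram_poly_rank_one square)
next
  case (weighted q v)
  then have "degree q \<le> v - 1" by simp
  from gram_poly_rank_one[OF this] show ?case
    by (intro exI[of _ "\<lambda>i j. coeff q i * coeff q j"] exI[of _ "\<lambda>i j. 0"] conjI psd_on_zero psd_on_rank_one)
      simp
next
  case (add v p q)
  then obtain Y Z Y' Z' where "psd_on {..v} Y" "psd_on {..v - 1} Z"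
    "p = gram_poly v Y + [:1, 0, -1:] * gram_poly (v - 1) Z"
    "psd_on {..v} Y'" "psd_on {..v - 1} Z'"
    "q = gram_poly v Y' + [:1, 0, -1:] * gram_poly (v - 1) Z'" by blast
  then show ?case
    by (intro exI[of _ "\<lambda>i j. Y i j + Y' i j"] exI[of _ "\<lambda>i j. Z i j + Z' i j"] conjI psd_on_add)
      (simp_all only: gram_poly_add distrib_left ac_simps)
qed

lemma trace_form_gram_poly: "trace_form G (gram_poly v Y) = pairing {..v} Y (P_mat G)"
  by (simp add: gram_poly_def trace_form_sum trace_form_monom pairing_def P_mat_def)

text \<open>The weight replaces \<open>t ^ (i + j)\<close> by its difference with
  \<open>t ^ (i + j + 2)\<close>; this is where the traces of the powers \<open>i + j + 1\<close>
  and \<open>i + j + 3\<close> in \<open>Q_mat\<close> come from.\<close>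

lemma trace_form_weighted_gram_poly:
  "trace_form G ([:1, 0, -1:] * gram_poly v Z) = pairing {..v} Z (Q_mat G)"
proof -
  have "[:1, 0, -1:] * monom c n = monom c n + monom (- c) (n + 2)" for c :: real and n
    by (simp add: monom_Suc minus_monom)
  then have "[:1, 0, -1:] * gram_poly v Z
      = (\<Sum>j\<le>v. \<Sum>i\<le>v. monom (Z i j) (i + j) + monom (- Z i j) (i + j + 2))"
    by (simp only: gram_poly_def sum_distrib_left)
  then show ?thesis
    by (simp only: trace_form_sum trace_form_add trace_form_monom pairing_def Q_mat_def)
      (simp add: const_poly_uminus algebra_simps numeral_3_eq_3)
qed

section \<open>The hierarchy and its semidefinite program\<close>

lemma nat_ceiling_half: "nat \<lceil>real k / 2\<rceil> = (k + 1) div 2"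
  by (cases "even k") (auto elim!: evenE oddE simp: add_divide_distrib ceiling_eq_iff intro!: nat_eq_iff[THEN iffD2])

lemma gram_ord_eq: "gram_ord G r = (h_deg G r + 1) div 2"
  by (simp add: gram_ord_def nat_ceiling_half)

lemma mat_deg_le: "mat_deg G \<le> 2 * half_deg G"
  unfolding half_deg_def nat_ceiling_half by linarith

text \<open>Brings the program into the shape of the hierarchy: a part from the cube and one trace
  form of a single univariate polynomial.\<close>

lemma sdp_poly_eq:
  "sdp_poly G r (t, X, Xs, Y, Z) = const_poly t
    + pairing (exps_upto r) X (\<lambda>\<alpha> \<beta>. xpow \<alpha> * xpow \<beta>)
    + (\<Sum>i\<in>UNIV. pairing (exps_upto (r - 1)) (Xs i) (\<lambda>\<alpha> \<beta>. xpow \<alpha> * xpow \<beta>) * ((xvar i)\<^sup>2 - xvar i))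
    + trace_form G (gram_poly (gram_ord G r) Y + [:1, 0, -1:] * gram_poly (gram_ord G r - 1) Z)"
proof -
  have "xvar i * (xvar i - 1) = (xvar i)\<^sup>2 - xvar i" for i :: 'a
    by (simp add: power2_eq_square right_diff_distrib)
  then show ?thesis
    unfolding sdp_poly_def trace_form_add trace_form_gram_poly trace_form_weighted_gram_poly prod.case
      pairing_mult_left
    by (simp only: mult.commute add.assoc)
qed

text \<open>Every certificate is a full polynomial identity, so its coefficients up to degree
  \<open>2 * r\<close> agree. Rounding up in \<open>gram_ord\<close> leaves room for
  \<open>h\<close> whatever the parity of its degree bound.\<close>

lemma Q_tilde_imp_feasible:
  fixes f :: "'n::finite mpoly" and G :: "('n mpoly)^'m^'m"
  assumes "transpose G = G" and "f - const_poly t \<in> Q_tilde G r"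
  shows "\<exists>X Xs Y Z. (t, X, Xs, Y, Z) \<in> conic_feasible (hierarchy_sdp f G r)"
proof -
  obtain \<sigma> p h where f: "f - const_poly t =
      \<sigma> + (\<Sum>i\<in>UNIV. p i * ((xvar i)\<^sup>2 - xvar i)) + trace_form G h"
    and \<sigma>: "sum_of_squares \<sigma>" "total_deg \<sigma> \<le> 2 * r"
    and p: "\<And>i. total_deg (p i) \<le> 2 * r - 2"
    and h: "degree h \<le> h_deg G r" "\<And>t. t \<in> {-1..1} \<Longrightarrow> 0 \<le> poly h t"
    using assms(2) unfolding Q_tilde_def cube_module_def H_set_def trace_poly_at_mat[OF assms(1)]
    by blast
  obtain X where X: "psd_on (exps_upto r) X" "\<sigma> = pairing (exps_upto r) X (\<lambda>\<alpha> \<beta>. xpow \<alpha> * xpow \<beta>)"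
    using sum_of_squares_imp_psd[OF \<sigma>] by blast
  have "\<exists>A. sym_on (exps_upto (r - 1)) A \<and>
      p i = pairing (exps_upto (r - 1)) A (\<lambda>\<alpha> \<beta>. xpow \<alpha> * xpow \<beta>)" for i
    using p[of i] by (intro symmetric_Gram_exists) (simp add: diff_mult_distrib2)
  then obtain Xs where Xs: "\<And>i. sym_on (exps_upto (r - 1)) (Xs i)"
      "\<And>i. p i = pairing (exps_upto (r - 1)) (Xs i) (\<lambda>\<alpha> \<beta>. xpow \<alpha> * xpow \<beta>)"
    by metis
  have "degree h \<le> 2 * gram_ord G r" using h(1) unfolding gram_ord_eq by linarith
  from interval_cert_imp_gram_poly[OF Lukacs[OF h(2) this]]
  obtain Y Z where YZ: "psd_on {..gram_ord G r} Y" "psd_on {..gram_ord G r - 1} Z"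
    "h = gram_poly (gram_ord G r) Y + [:1, 0, -1:] * gram_poly (gram_ord G r - 1) Z" by auto
  have "f = const_poly t + (f - const_poly t)" by simp
  also have "\<dots> = sdp_poly G r (t, X, Xs, Y, Z)"
    unfolding f sdp_poly_eq X(2) Xs(2) YZ(3) by (simp only: add.assoc)
  finally show ?thesis
    using X(1) Xs(1) YZ(1,2) by (auto simp: conic_feasible_def hierarchy_sdp_def)
qed

text \<open>For even \<open>h_deg G r\<close> rounding does not enlarge the degree bound, so the
  Gram matrices give an admissible \<open>h\<close>, and no coefficient beyond degree
  \<open>2 * r\<close> is lost.\<close>

lemma feasible_imp_Q_tilde:
  fixes f :: "'n::finite mpoly" and G :: "('n mpoly)^'m^'m"
  assumes sym: "transpose G = G" and l: "0 < half_deg G" "2 * half_deg G \<le> r"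
    and f: "total_deg f \<le> 2 * r" and even: "even (h_deg G r)"
    and feas: "(t, X, Xs, Y, Z) \<in> conic_feasible (hierarchy_sdp f G r)"
  shows "f - const_poly t \<in> Q_tilde G r"
proof -
  define h where "h = gram_poly (gram_ord G r) Y + [:1, 0, -1:] * gram_poly (gram_ord G r - 1) Z"
  have psd: "psd_on (exps_upto r) X" "psd_on {..gram_ord G r} Y" "psd_on {..gram_ord G r - 1} Z"
    and coefs: "\<And>\<alpha>. \<alpha> \<in> exps_upto (2 * r) \<Longrightarrow> coef (sdp_poly G r (t, X, Xs, Y, Z)) \<alpha> = coef f \<alpha>"
    using feas by (auto simp: conic_feasible_def hierarchy_sdp_def)
  \<comment> \<open>With evenness this makes \<open>gram_ord G r\<close> positive, so that
    \<open>gram_ord G r - 1\<close> is a true subtraction in the degree count.\<close>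
  have "2 \<le> r div half_deg G" using l by (metis div_le_mono nonzero_mult_div_cancel_right not_gr0)
  then have k: "h_deg G r + 1 = r div half_deg G" "1 \<le> h_deg G r" by (simp_all add: h_deg_def)
  then have v: "h_deg G r = 2 * gram_ord G r" "1 \<le> gram_ord G r"
    using even unfolding gram_ord_eq by (auto elim!: evenE)
  have r: "1 \<le> r" using l by linarith
  have hdeg: "degree h \<le> h_deg G r"
    unfolding h_def v(1)
  proof (rule degree_add_le[OF degree_gram_poly])
    have "degree ([:1, 0, -1:] * gram_poly (gram_ord G r - 1) Z) \<le> 2 + 2 * (gram_ord G r - 1)"
      using degree_gram_poly[of "gram_ord G r - 1" Z] by (intro order.trans[OF degree_mult_le]) simp
    then show "degree ([:1, 0, -1:] * gram_poly (gram_ord G r - 1) Z) \<le> 2 * gram_ord G r"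
      using v(2) by linarith
  qed
  have hpos: "0 \<le> poly h t" if "t \<in> {-1..1}" for t
  proof -
    have "0 \<le> (1 - t) * (1 + t)" using that by (intro mult_nonneg_nonneg) auto
    moreover have "poly h t = poly (gram_poly (gram_ord G r) Y) t
        + (1 - t) * (1 + t) * poly (gram_poly (gram_ord G r - 1) Z) t"
      by (simp add: h_def algebra_simps)
    ultimately show ?thesis using psd poly_gram_poly_nonneg by simp
  qed
  let ?\<sigma> = "pairing (exps_upto r) X (\<lambda>\<alpha> \<beta>. xpow \<alpha> * xpow \<beta>)"
  let ?p = "\<lambda>i. pairing (exps_upto (r - 1)) (Xs i) (\<lambda>\<alpha> \<beta>. xpow \<alpha> * xpow \<beta>)"
  have p: "total_deg (?p i) \<le> 2 * r - 2" for i
    using total_deg_pairing_xpow[of "r - 1" "Xs i"] by (simp add: diff_mult_distrib2)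
  have eq: "sdp_poly G r (t, X, Xs, Y, Z) = const_poly t + ?\<sigma>
      + (\<Sum>i\<in>UNIV. ?p i * ((xvar i)\<^sup>2 - xvar i)) + trace_form G h"
    by (simp add: sdp_poly_eq h_def)
  \<comment> \<open>Here \<open>h_deg G r + 1\<close> is the quotient
    \<open>r div half_deg G\<close>, hence its product with \<open>half_deg G\<close> is at most
    \<open>r\<close>.\<close>
  have "(h_deg G r + 1) * mat_deg G \<le> (h_deg G r + 1) * (2 * half_deg G)"
    by (intro mult_left_mono mat_deg_le) simp
  also have "\<dots> \<le> 2 * r" unfolding k(1) by simp
  finally have "total_deg (trace_form G h) \<le> 2 * r"
    using total_deg_trace_form[OF hdeg, of G] by linarith
  moreover have "total_deg (?p i * ((xvar i)\<^sup>2 - xvar i)) \<le> 2 * r" for i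
  proof -
    have "total_deg ((xvar i)\<^sup>2 - xvar i) \<le> 1 + 1"
      unfolding power2_eq_square
      by (intro total_deg_diff total_deg_mult total_deg_xvar order.trans[OF total_deg_xvar]) simp
    from total_deg_mult[OF p[of i] this] show ?thesis using r by simp
  qed
  ultimately have "total_deg (sdp_poly G r (t, X, Xs, Y, Z)) \<le> 2 * r"
    unfolding eq by (intro total_deg_add total_deg_sum total_deg_pairing_xpow total_deg_const_poly)
  then have "f = sdp_poly G r (t, X, Xs, Y, Z)"
    using f coefs by (intro mpoly_eqI) (metis coef_eq_zero total_deg_le_iff)
  then have "f - const_poly t = ?\<sigma> + (\<Sum>i\<in>UNIV. ?p i * ((xvar i)\<^sup>2 - xvar i)) + trace_form G h"
    by (simp add: eq)
  moreover have "?\<sigma> + (\<Sum>i\<in>UNIV. ?p i * ((xvar i)\<^sup>2 - xvar i)) \<in> cube_module r"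
    unfolding cube_module_def
    by (intro CollectI exI[of _ ?\<sigma>] exI[of _ ?p] conjI allI refl psd_imp_sum_of_squares psd(1) total_deg_pairing_xpow p)
  moreover have "trace_form G h \<in> H_set G (h_deg G r)"
    unfolding H_set_def trace_poly_at_mat[OF sym] using hdeg hpos by blast
  ultimately show ?thesis unfolding Q_tilde_def by blast
qed

section \<open>The dual program\<close>

lemma riesz_eq_sum:
  assumes "finite S" "Poly_Mapping.keys p \<subseteq> S"
  shows "riesz y p = (\<Sum>\<alpha>\<in>S. coef p \<alpha> * y \<alpha>)"
  unfolding riesz_def using assms
  by (intro sum.mono_neutral_left) (auto simp: coef_def in_keys_iff)

lemma riesz_zero [simp]: "riesz y 0 = 0"
  by (simp add: riesz_def)

lemma riesz_add: "riesz y (p + q) = riesz y p + riesz y q"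
proof -
  let ?S = "Poly_Mapping.keys p \<union> Poly_Mapping.keys q"
  have "riesz y (p + q) = (\<Sum>\<alpha>\<in>?S. coef (p + q) \<alpha> * y \<alpha>)"
    by (intro riesz_eq_sum) (use keys_add[of p q] in auto)
  also have "\<dots> = (\<Sum>\<alpha>\<in>?S. coef p \<alpha> * y \<alpha>) + (\<Sum>\<alpha>\<in>?S. coef q \<alpha> * y \<alpha>)"
    by (simp add: coef_add distrib_right sum.distrib)
  also have "\<dots> = riesz y p + riesz y q"
    using riesz_eq_sum[of ?S p] riesz_eq_sum[of ?S q] by simp
  finally show ?thesis .
qed

lemma riesz_sum: "riesz y (\<Sum>i\<in>I. p i) = (\<Sum>i\<in>I. riesz y (p i))"
  by (induction I rule: infinite_finite_induct) (simp_all add: riesz_add)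

lemma riesz_const_mult: "riesz y (const_poly c * p) = c * riesz y p"
proof -
  have "riesz y (const_poly c * p) = (\<Sum>\<alpha>\<in>Poly_Mapping.keys p. coef (const_poly c * p) \<alpha> * y \<alpha>)"
    using coef_const_mult[of c p] by (intro riesz_eq_sum) (auto simp: coef_def in_keys_iff)
  then show ?thesis by (simp add: coef_const_mult riesz_def sum_distrib_left mult.assoc)
qed

lemma riesz_const_poly: "riesz y (const_poly c) = c * y 0"
  by (simp add: riesz_def const_poly_def coef_def)

lemma riesz_pairing:
  "riesz y (pairing I A M) = (\<Sum>j\<in>I. \<Sum>i\<in>I. A i j * riesz y (M i j))"
  by (simp add: pairing_def riesz_sum riesz_const_mult)

text \<open>As \<open>y\<close> vanishes off \<open>I\<close>, coefficients outside are ignored. So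
  the adjoint of the truncated constraints is the Riesz functional of the full
  \<open>sdp_poly\<close>.\<close>

lemma riesz_coord_space:
  assumes "y \<in> coord_space I" "finite I"
  shows "riesz y p = (\<Sum>\<alpha>\<in>I. y \<alpha> * coef p \<alpha>)"
proof -
  have "riesz y p = (\<Sum>\<alpha>\<in>I \<union> Poly_Mapping.keys p. coef p \<alpha> * y \<alpha>)"
    using assms(2) by (intro riesz_eq_sum) auto
  also have "\<dots> = (\<Sum>\<alpha>\<in>I. coef p \<alpha> * y \<alpha>)"
    using assms by (intro sum.mono_neutral_right) (auto simp: coord_space_def)
  finally show ?thesis by (simp add: mult.commute)
qed

lemma riesz_sdp_poly:
  "riesz y (sdp_poly G r (t, X, Xs, Y, Z)) = t * y 0
    + mat_inner (exps_upto r) X (moment_mat y)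
    + (\<Sum>i\<in>UNIV. mat_inner (exps_upto (r - 1)) (Xs i) (localizing_mat (xvar i * (xvar i - 1)) y))
    + mat_inner {..gram_ord G r} Y (\<lambda>i j. riesz y (P_mat G i j))
    + mat_inner {..gram_ord G r - 1} Z (\<lambda>i j. riesz y (Q_mat G i j))"
  by (simp add: sdp_poly_def riesz_add riesz_sum riesz_pairing riesz_const_poly
      moment_mat_def localizing_mat_def mat_inner_def)

text \<open>The functional is a sum over independent blocks, hence nonnegative on the product cone
  exactly when it is so on each block, which is seen by setting the other blocks to zero.\<close>

lemma hierarchy_sdp_dual_feasible_iff:
  fixes y :: "'n::finite exponent \<Rightarrow> real"
  assumes y: "y \<in> coord_space (exps_upto (2 * r))"
  shows "(\<lambda>x. (\<Sum>\<alpha>\<in>exps_upto (2 * r). y \<alpha> * coef (sdp_poly G r x) \<alpha>) - cp_obj (hierarchy_sdp f G r) x)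
      \<in> dual_cone (cp_cone (hierarchy_sdp f G r)) \<longleftrightarrow>
    y 0 = 1 \<and> psd_on (exps_upto r) (moment_mat y)
    \<and> (\<forall>i. \<forall>\<alpha>\<in>exps_upto (r - 1). \<forall>\<beta>\<in>exps_upto (r - 1).
          localizing_mat (xvar i * (xvar i - 1)) y \<alpha> \<beta> = 0)
    \<and> psd_on {..gram_ord G r} (\<lambda>i j. riesz y (P_mat G i j))
    \<and> psd_on {..gram_ord G r - 1} (\<lambda>i j. riesz y (Q_mat G i j))"
    (is "?L \<longleftrightarrow> ?R")
proof -
  let ?M = "moment_mat y" and ?P = "\<lambda>i j. riesz y (P_mat G i j)" and ?Q = "\<lambda>i j. riesz y (Q_mat G i j)"
  let ?N = "\<lambda>i. localizing_mat (xvar i * (xvar i - 1)) y"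
  let ?I = "exps_upto r" and ?I' = "exps_upto (r - 1)" and ?J = "{..gram_ord G r}" and ?J' = "{..gram_ord G r - 1}"
  \<comment> \<open>Symmetry of the dual matrices is automatic, and the two duality lemmas for
    single blocks ask for it.\<close>
  have sym: "sym_on ?I ?M" "\<And>i. sym_on ?I' (?N i)" "sym_on ?J ?P" "sym_on ?J' ?Q"
    by (simp_all add: sym_on_def moment_mat_def localizing_mat_def P_mat_def Q_mat_def mult.commute add.commute)
  have L: "?L \<longleftrightarrow> (\<forall>t X Xs Y Z. psd_on ?I X \<longrightarrow> (\<forall>i. sym_on ?I' (Xs i)) \<longrightarrow> psd_on ?J Y \<longrightarrow> psd_on ?J' Z \<longrightarrow>
      0 \<le> t * y 0 + mat_inner ?I X ?M + (\<Sum>i\<in>UNIV. mat_inner ?I' (Xs i) (?N i)) + mat_inner ?J Y ?P + mat_inner ?J' Z ?Q - t)"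
    unfolding riesz_coord_space[OF y finite_exps_upto, symmetric]
    by (simp add: dual_cone_def hierarchy_sdp_def riesz_sdp_poly) blast
  note self_dual = psd_on_self_dual[OF finite_exps_upto sym(1)]
    psd_on_self_dual[OF finite_atMost sym(3)]
    psd_on_self_dual[OF finite_atMost sym(4)]
    sym_on_dual[OF finite_exps_upto sym(2)]
  have sz: "sym_on I (\<lambda>\<alpha> \<beta>. 0 :: real)" for I by (simp add: sym_on_def)
  show ?thesis
  proof
    assume ?L
    then have *: "0 \<le> t * y 0 + mat_inner ?I X ?M + (\<Sum>i\<in>UNIV. mat_inner ?I' (Xs i) (?N i)) + mat_inner ?J Y ?P + mat_inner ?J' Z ?Q - t"
      if "psd_on ?I X" "\<And>i. sym_on ?I' (Xs i)" "psd_on ?J Y" "psd_on ?J' Z" for t X Xs Y Z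
      using that unfolding L by blast
    let ?z = "\<lambda>_ _. 0 :: real"
    \<comment> \<open>The variable \<open>t\<close> has no sign, so \<open>1\<close> and
      \<open>-1\<close> are both test values and force an equation.\<close>
    have "0 \<le> 1 * y 0 - 1" "0 \<le> - 1 * y 0 - - 1"
      using *[of ?z "\<lambda>_. ?z" ?z ?z 1] *[of ?z "\<lambda>_. ?z" ?z ?z "-1"]
      by (simp_all add: psd_on_zero sz)
    then have "y 0 = 1" by simp
    moreover have "\<forall>A. psd_on ?I A \<longrightarrow> 0 \<le> mat_inner ?I A ?M"
      using *[of _ "\<lambda>_. ?z" ?z ?z 0] by (simp add: psd_on_zero sz)
    moreover have "\<forall>A. psd_on ?J A \<longrightarrow> 0 \<le> mat_inner ?J A ?P"
      using *[of ?z "\<lambda>_. ?z" _ ?z 0] by (simp add: psd_on_zero sz)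
    moreover have "\<forall>A. psd_on ?J' A \<longrightarrow> 0 \<le> mat_inner ?J' A ?Q"
      using *[of ?z "\<lambda>_. ?z" ?z _ 0] by (simp add: psd_on_zero sz)
    \<comment> \<open>Only the block of the variable \<open>i\<close> is nonzero in the test
      point.\<close>
    moreover have "\<forall>A. sym_on ?I' A \<longrightarrow> 0 \<le> mat_inner ?I' A (?N i)" for i
    proof (intro allI impI)
      fix A :: "'n exponent \<Rightarrow> 'n exponent \<Rightarrow> real" assume A: "sym_on ?I' A"
      have "(\<Sum>k\<in>UNIV. mat_inner ?I' (if k = i then A else ?z) (?N k)) = mat_inner ?I' A (?N i)"
        by (simp add: if_distrib[of "\<lambda>A. mat_inner _ A _"] cong: if_cong)
      then show "0 \<le> mat_inner ?I' A (?N i)"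
        using *[of ?z "\<lambda>k. if k = i then A else ?z" ?z ?z 0] A by (simp add: psd_on_zero sz)
    qed
    ultimately show ?R unfolding self_dual by blast
  next
    assume ?R
    then have "y 0 = 1" and nonneg: "\<And>A. psd_on ?I A \<Longrightarrow> 0 \<le> mat_inner ?I A ?M"
      "\<And>A. psd_on ?J A \<Longrightarrow> 0 \<le> mat_inner ?J A ?P" "\<And>A. psd_on ?J' A \<Longrightarrow> 0 \<le> mat_inner ?J' A ?Q"
      "\<And>A i. sym_on ?I' A \<Longrightarrow> 0 \<le> mat_inner ?I' A (?N i)"
      unfolding self_dual[symmetric] by blast+
    then show ?L unfolding L by (auto intro!: add_nonneg_nonneg sum_nonneg)
  qed
qed

text \<open>The dual is identified as a problem, by its feasible set and objective. The two
  comparisons of values tie the program to the hierarchy.\<close>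

theorem corollary3p2:
  fixes f :: "'n::finite mpoly" and G :: "('n mpoly)^'m^'m" and r :: nat
  assumes "transpose G = G"
    and "0 < half_deg G"
    and "3 * half_deg G \<le> r"
    and "total_deg f \<le> 2 * r"
  shows "conic_dual (hierarchy_sdp f G r) =
      ({y \<in> coord_space (exps_upto (2 * r)).
          y 0 = 1
          \<and> psd_on (exps_upto r) (moment_mat y)
          \<and> (\<forall>i. \<forall>\<alpha>\<in>exps_upto (r - 1). \<forall>\<beta>\<in>exps_upto (r - 1).
                localizing_mat (xvar i * (xvar i - 1)) y \<alpha> \<beta> = 0)
          \<and> psd_on {..nat \<lceil>(real (r div half_deg G) - 1) / 2\<rceil>}
                (\<lambda>i j. riesz y (P_mat G i j))
          \<and> psd_on {..nat \<lceil>(real (r div half_deg G) - 1) / 2\<rceil> - 1}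
                (\<lambda>i j. riesz y (Q_mat G i j))},
       \<lambda>y. riesz y f)
    \<and> lb f G r \<le> conic_value (hierarchy_sdp f G r)
    \<and> (even (r div half_deg G - 1) \<longrightarrow> lb f G r = conic_value (hierarchy_sdp f G r))"
proof -
  have "1 \<le> r div half_deg G"
    using assms(2,3) by (simp add: Suc_le_eq div_greater_zero_iff)
  \<comment> \<open>The real subtraction in the statement agrees with the truncated one in
    \<open>h_deg\<close> because the quotient is at least one.\<close>
  then have v: "nat \<lceil>(real (r div half_deg G) - 1) / 2\<rceil> = gram_ord G r"
    by (simp add: gram_ord_def h_deg_def of_nat_diff)
  \<comment> \<open>The degree bound on \<open>f\<close> ensures that every coefficient of
    \<open>f\<close> is among the right-hand sides.\<close>
  have obj: "(\<Sum>\<alpha>\<in>exps_upto (2 * r). coef f \<alpha> * y \<alpha>) = riesz y f" for y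
    using assms(4) by (intro riesz_eq_sum[symmetric]) (simp_all add: total_deg_le_iff)
  have "cp_index (hierarchy_sdp f G r) = exps_upto (2 * r)"
    "cp_lhs (hierarchy_sdp f G r) = (\<lambda>\<alpha> x. coef (sdp_poly G r x) \<alpha>)"
    "cp_rhs (hierarchy_sdp f G r) = coef f"
    by (simp_all add: hierarchy_sdp_def)
  then have dual: "conic_dual (hierarchy_sdp f G r) =
      ({y \<in> coord_space (exps_upto (2 * r)).
          y 0 = 1
          \<and> psd_on (exps_upto r) (moment_mat y)
          \<and> (\<forall>i. \<forall>\<alpha>\<in>exps_upto (r - 1). \<forall>\<beta>\<in>exps_upto (r - 1).
                localizing_mat (xvar i * (xvar i - 1)) y \<alpha> \<beta> = 0)
          \<and> psd_on {..gram_ord G r} (\<lambda>i j. riesz y (P_mat G i j))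
          \<and> psd_on {..gram_ord G r - 1} (\<lambda>i j. riesz y (Q_mat G i j))},
       \<lambda>y. riesz y f)"
    unfolding conic_dual_def
    by (simp only: obj hierarchy_sdp_dual_feasible_iff cong: conj_cong)
  have obj': "cp_obj (hierarchy_sdp f G r) (t, X, Xs, Y, Z) = t" for t X Xs Y Z
    by (simp add: hierarchy_sdp_def)
  have le: "lb f G r \<le> conic_value (hierarchy_sdp f G r)"
    unfolding lb_def
  proof (rule SUP_least)
    fix t assume "t \<in> {t. f - const_poly t \<in> Q_tilde G r}"
    then obtain X Xs Y Z where "(t, X, Xs, Y, Z) \<in> conic_feasible (hierarchy_sdp f G r)"
      using Q_tilde_imp_feasible[OF assms(1)] by blast
    then show "ereal t \<le> conic_value (hierarchy_sdp f G r)"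
      unfolding conic_value_def by (rule SUP_upper2) (simp add: obj')
  qed
  have "conic_value (hierarchy_sdp f G r) \<le> lb f G r" if "even (r div half_deg G - 1)"
    unfolding conic_value_def
  proof (rule SUP_least)
    fix x assume x: "x \<in> conic_feasible (hierarchy_sdp f G r)"
    obtain t X Xs Y Z where [simp]: "x = (t, X, Xs, Y, Z)" by (cases x) auto
    have "f - const_poly t \<in> Q_tilde G r"
      using x assms that by (intro feasible_imp_Q_tilde[of G r f t X Xs Y Z]) (auto simp: h_deg_def)
    then show "ereal (cp_obj (hierarchy_sdp f G r) x) \<le> lb f G r"
      unfolding lb_def by (intro SUP_upper2[of t]) (auto simp: obj')
  qed
  with le dual show ?thesis unfolding v by (auto intro: antisym)
qed

end
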